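(* Suppose the Markov system $\mathcal{M}=(K_{i(e)},w_e,p_e)_{e\in E}$ is contractive with a contraction rate $0<a<1$, the functions $p_e|_{K_{i(e)}}$ are Dini-continuous, and there exists $\delta>0$ such that $p_e|_{K_{i(e)}}\ge\delta$ for all $e\in E$. Suppose $M\in E(\mathcal{M})$. Let $0<\beta<\delta\log(1/a)/(1+\delta\log(1/a))$ and $q:=\beta/((1-\beta)\delta\log(1/a))$. Then $$\Phi_\beta(Q)\geq M(Q)^{\frac1\beta}\,\frac{1}{|\mathbb{S}|}\,e^{-\frac1\delta\left[\frac{1}{1-a^q}+\sum_{i=0}^\infty\Delta\left(a^{(1-q)i}C\right)\right]}\qquad\text{for all }Q\in\mathcal{B}(\Sigma).$$
   Context: Markov system: Let $(K,d)$ be a complete separable metric space partitioned into non-empty Borel subsets $K_1,\dots,K_N$. Let $E$ be the finite edge set of a directed multigraph with vertex set $\{1,\dots,N\}$; $i(e),t(e)$ denote the initial and terminal vertex of $e$. For each $e\in E$ let $w_e$ be a Borel measurable map with $w_e(K_{i(e)})\subset K_{t(e)}$ and $p_e:K\to[0,1]$ a Borel function vanishing outside $K_{i(e)}$, with $\sum_{e\in E,\,i(e)=j}p_e(x)=1$ for all $x\in K_j$, $j=1,\dots,N$. The Markov system $\mathcal{M}=(K_{i(e)},w_e,p_e)_{e\in E}$ is contractive with contraction rate $0<a<1$ if $\sum_{e\in E,\,i(e)=j}p_e(x)d(w_ex,w_ey)\le a\,d(x,y)$ for all $x,y\in K_j$, $j=1,\dots,N$. A function $h$ on a metric space is Dini-continuous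 if its modulus $\varphi(t)=\sup\{|h(x)-h(y)|:d(x,y)\le t\}$ satisfies $\int_0^c\varphi(t)/t\,dt<\infty$ for some $c>0$. Let $\mu$ be an invariant Borel probability measure of $\mathcal{M}$: $\mu(B)=\sum_{e\in E}\int_{K_{i(e)}}p_e(x)1_B(w_ex)\,d\mu(x)$ for all Borel $B\subset K$. Code space: $\Sigma=E^{\mathbb{Z}}$ (product topology), $\mathcal{B}(\Sigma)$ its Borel $\sigma$-algebra, $S$ the left shift $(S\sigma)_i=\sigma_{i+1}$, ${}_m[e_m,\dots,e_n]=\{\sigma:\sigma_i=e_i,\ m\le i\le n\}$; $\mathcal{A}_m$ is the $\sigma$-algebra generated by the cylinders ${}_m[e_m,\dots,e_n]$, $n\ge m$. For $x\in K$, $P^m_x$ is the probability measure on $\mathcal{A}_m$ with $P^m_x({}_m[e_m,\dots,e_n])=p_{e_m}(x)p_{e_{m+1}}(w_{e_m}x)\cdots p_{e_n}(w_{e_{n-1}}\circ\dots\circ w_{e_m}x)$, understood as $0$ unless $x\in K_{i(e_m)}$ and $(e_m,\dots,e_n)$ is a path. For a Borel probability measure $\nu$ on $K$, $\Phi_0(\nu)(A)=\int P^0_x(A)\,d\nu(x)$, $A\in\mathcal{A}_0$. $M$ is the $S$-invariant Borel probability measure on $\Sigma$ with $M({}_m[e_m,\dots,e_n])=\int P^m_x({}_m[e_m,\dots,e_n])\,d\mu(x)$ for all $m\le n$ in $\mathbb{Z}$. Coding map: Fix $x_i\in K_i$, $i=1,\dots,N$. Let $\Sigma_G=\{\sigma\in\Sigma:i(\sigma_{k+1})=t(\sigma_k)\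 \forall k\in\mathbb{Z}\}$ and let $D$ be the set of $\sigma\in\Sigma_G$ for which $\lim_{m\to-\infty}w_{\sigma_0}\circ w_{\sigma_{-1}}\circ\dots\circ w_{\sigma_m}(x_{i(\sigma_m)})$ exists in $K$. Let $F(\sigma)$ be this limit if $\sigma\in D$, and $F(\sigma)=x_{t(\sigma_0)}$ otherwise. Let $\mathcal{F}$ be the $\sigma$-algebra generated by the cylinders ${}_m[e_m,\dots,e_0]$, $m\le 0$. $E(\mathcal{M})$ is the set of all $S$-invariant Borel probability measures $\Lambda$ on $\Sigma$ with $\Lambda(D)=1$ and $E_\Lambda(1_{{}_1[e]}|\mathcal{F})=p_e\circ F$ $\Lambda$-a.e. for all $e\in E$. Initial measure and set function: $\mathbb{S}$ is a set with $\{i: M(F^{-1}(K_i))>0\}\subset\mathbb{S}\subset\{1,\dots,N\}$, $|\mathbb{S}|$ is its size, $\lambda'=\frac{1}{|\mathbb{S}|}\sum_{i\in\mathbb{S}}\delta_{x_i}$, and $\phi_0:=\Phi_0(\lambda')$. For $Q\subset\Sigma$ let $\mathcal{C}(Q)$ be the set of sequences $(A_m)_{m\le0}$ with $A_m\in\mathcal{A}_m$ for all $m\le 0$ and $Q\subset\bigcup_{m\le0}A_m$ (so $S^mA_m\in\mathcal{A}_0$), and for $0<\beta\le1$ put $$\Phi_\beta(Q):=\inf_{(A_m)_{m\le0}\in\mathcal{C}(Q)}\left(\sum_{m\le0}\phi_0(S^mA_m)^\beta\right)^{1/\beta}.$$ Constants: $C=\sum_{j=1}^N\int_{K_j}d(x,x_j)\,d\mu(x)$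 (known to be finite when $\mathcal{M}$ is contractive), $\Delta(t)=\sup_{e\in E}\sup_{x,y\in K_{i(e)},\,d(x,y)\le t}|p_e(x)-p_e(y)|$ for $t\ge0$. *)

theory Defs
  imports "HOL-Probability.Probability"
begin

text \<open>The complete separable metric space is the whole type \<open>'a\<close>, partitioned into
  \<open>K 1, \<dots>, K N\<close>. The edges of the multigraph on \<open>{1..N}\<close> are the elements of the finite type
  \<open>'e\<close>, with initial vertex \<open>ini e\<close> and terminal vertex \<open>ter e\<close>.\<close>

locale markov_system =
  fixes N :: nat
    and K :: "nat \<Rightarrow> 'a::polish_space set"
    and ini ter :: "'e::finite \<Rightarrow> nat"
    and w :: "'e \<Rightarrow> 'a \<Rightarrow> 'a"
    and p :: "'e \<Rightarrow> 'a \<Rightarrow> real"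
  assumes cell_borel: "j \<in> {1..N} \<Longrightarrow> K j \<in> sets borel"
    and cell_nonempty: "j \<in> {1..N} \<Longrightarrow> K j \<noteq> {}"
    and cell_disjoint: "disjoint_family_on K {1..N}"
    and cell_cover: "(\<Union>j\<in>{1..N}. K j) = UNIV"
    and ini_vertex: "ini e \<in> {1..N}"
    and ter_vertex: "ter e \<in> {1..N}"
    and w_borel: "w e \<in> borel \<rightarrow>\<^sub>M borel"
    and w_cell: "w e ` K (ini e) \<subseteq> K (ter e)"
    and p_borel: "p e \<in> borel_measurable borel"
    and p_range: "p e x \<in> {0..1}"
    and p_outside: "x \<notin> K (ini e) \<Longrightarrow> p e x = 0"
    and p_sum: "j \<in> {1..N} \<Longrightarrow> x \<in> K j \<Longrightarrow> (\<Sum>e | ini e = j. p e x) = 1"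

definition contractive ::
  "nat \<Rightarrow> (nat \<Rightarrow> 'a::metric_space set) \<Rightarrow> ('e::finite \<Rightarrow> nat) \<Rightarrow> ('e \<Rightarrow> 'a \<Rightarrow> 'a) \<Rightarrow>
    ('e \<Rightarrow> 'a \<Rightarrow> real) \<Rightarrow> real \<Rightarrow> bool" where
  "contractive N K ini w p a \<longleftrightarrow> 0 < a \<and> a < 1 \<and>
    (\<forall>j\<in>{1..N}. \<forall>x\<in>K j. \<forall>y\<in>K j.
      (\<Sum>e | ini e = j. p e x * dist (w e x) (w e y)) \<le> a * dist x y)"

definition modulus_on :: "'a::metric_space set \<Rightarrow> ('a \<Rightarrow> real) \<Rightarrow> real \<Rightarrow> ennreal" where
  "modulus_on X h t =
    (SUP (x, y)\<in>{(x, y). x \<in> X \<and> y \<in> X \<and> dist x y \<le> t}. ennreal \<bar>h x - h y\<bar>)"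

definition dini_continuous_on :: "'a::metric_space set \<Rightarrow> ('a \<Rightarrow> real) \<Rightarrow> bool" where
  "dini_continuous_on X h \<longleftrightarrow>
    (\<exists>c>0. (\<integral>\<^sup>+t\<in>{0<..c}. modulus_on X h t / ennreal t \<partial>lborel) < \<infinity>)"

definition invariant_measure ::
  "(nat \<Rightarrow> 'a::topological_space set) \<Rightarrow> ('e::finite \<Rightarrow> nat) \<Rightarrow> ('e \<Rightarrow> 'a \<Rightarrow> 'a) \<Rightarrow>
    ('e \<Rightarrow> 'a \<Rightarrow> real) \<Rightarrow> 'a measure \<Rightarrow> bool" where
  "invariant_measure K ini w p \<mu> \<longleftrightarrow> prob_space \<mu> \<and> sets \<mu> = sets borel \<and>
    (\<forall>B\<in>sets borel.
      measure \<mu> B = (\<Sum>e\<in>UNIV. LINT x:K (ini e)|\<mu>. p e x * indicator B (w e x)))"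

text \<open>The Borel \<open>\<sigma>\<close>-algebra of the product of discrete topologies on \<open>int \<Rightarrow> 'e\<close>.\<close>

definition code_borel :: "(int \<Rightarrow> 'e) measure" where
  "code_borel = sigma UNIV {U. openin (product_topology (\<lambda>_. discrete_topology UNIV) UNIV) U}"

text \<open>\<open>shift k\<close> is the \<open>k\<close>-th iterate, \<open>k \<in> \<int>\<close>, of the left shift \<open>shift 1\<close>.\<close>

definition shift :: "int \<Rightarrow> (int \<Rightarrow> 'e) \<Rightarrow> (int \<Rightarrow> 'e)" where
  "shift k \<sigma> = (\<lambda>i. \<sigma> (i + k))"

definition shift_invariant :: "(int \<Rightarrow> 'e) measure \<Rightarrow> bool" where
  "shift_invariant \<Lambda> \<longleftrightarrow>
    (\<forall>A\<in>sets \<Lambda>. emeasure \<Lambda> (shift 1 -` A) = emeasure \<Lambda> A)"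

text \<open>The cylinder of all \<open>\<sigma>\<close> with \<open>\<sigma>\<^sub>m, \<sigma>\<^sub>m\<^sub>+\<^sub>1, \<dots>\<close> starting with the list \<open>es\<close>.\<close>

definition cylinder :: "int \<Rightarrow> 'e list \<Rightarrow> (int \<Rightarrow> 'e) set" where
  "cylinder m es = {\<sigma>. \<forall>k<length es. \<sigma> (m + int k) = es ! k}"

definition future :: "int \<Rightarrow> (int \<Rightarrow> 'e) measure" where
  "future m = sigma UNIV {cylinder m es |es. es \<noteq> []}"

definition past :: "(int \<Rightarrow> 'e) measure" where
  "past = sigma UNIV {cylinder m es |m es. es \<noteq> [] \<and> m + int (length es) = 1}"

text \<open>In a Markov system, \<open>p e\<close> vanishes outside \<open>K (ini e)\<close> and \<open>w e\<close> maps \<open>K (ini e)\<close> into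
  \<open>K (ter e)\<close>. So this product is automatically \<open>0\<close> unless the list is a path starting in the
  cell of \<open>x\<close>.\<close>

primrec path_prob :: "('e \<Rightarrow> 'a \<Rightarrow> 'a) \<Rightarrow> ('e \<Rightarrow> 'a \<Rightarrow> real) \<Rightarrow> 'a \<Rightarrow> 'e list \<Rightarrow> real" where
  "path_prob w p x [] = 1"
| "path_prob w p x (e # es) = p e x * path_prob w p (w e x) es"

definition path_measure ::
  "('e \<Rightarrow> 'a \<Rightarrow> 'a) \<Rightarrow> ('e \<Rightarrow> 'a \<Rightarrow> real) \<Rightarrow> int \<Rightarrow> 'a \<Rightarrow> (int \<Rightarrow> 'e) measure" where
  "path_measure w p m x = (THE P. prob_space P \<and> sets P = sets (future m) \<and>
    (\<forall>es. es \<noteq> [] \<longrightarrow> measure P (cylinder m es) = path_prob w p x es))"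

definition Phi_0 ::
  "('e \<Rightarrow> 'a \<Rightarrow> 'a) \<Rightarrow> ('e \<Rightarrow> 'a \<Rightarrow> real) \<Rightarrow> 'a measure \<Rightarrow> (int \<Rightarrow> 'e) set \<Rightarrow> ennreal" where
  "Phi_0 w p \<nu> A = (\<integral>\<^sup>+x. emeasure (path_measure w p 0 x) A \<partial>\<nu>)"

text \<open>For invariant \<open>\<mu>\<close>, these conditions determine \<open>M\<close> uniquely.\<close>

definition code_measure ::
  "('e \<Rightarrow> 'a \<Rightarrow> 'a) \<Rightarrow> ('e \<Rightarrow> 'a \<Rightarrow> real) \<Rightarrow> 'a measure \<Rightarrow> (int \<Rightarrow> 'e) measure \<Rightarrow> bool" where
  "code_measure w p \<mu> M \<longleftrightarrow> prob_space M \<and> sets M = sets code_borel \<and> shift_invariant M \<and>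
    (\<forall>m es. es \<noteq> [] \<longrightarrow>
      measure M (cylinder m es) = (LINT x|\<mu>. measure (path_measure w p m x) (cylinder m es)))"

definition path_space :: "('e \<Rightarrow> nat) \<Rightarrow> ('e \<Rightarrow> nat) \<Rightarrow> (int \<Rightarrow> 'e) set" where
  "path_space ini ter = {\<sigma>. \<forall>k. ini (\<sigma> (k + 1)) = ter (\<sigma> k)}"

text \<open>\<open>back_comp w \<sigma> n\<close> is \<open>w \<sigma>\<^sub>0 \<circ> w \<sigma>\<^sub>-\<^sub>1 \<circ> \<dots> \<circ> w \<sigma>\<^sub>-\<^sub>n\<close>.\<close>

primrec back_comp :: "('e \<Rightarrow> 'a \<Rightarrow> 'a) \<Rightarrow> (int \<Rightarrow> 'e) \<Rightarrow> nat \<Rightarrow> 'a \<Rightarrow> 'a" where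
  "back_comp w \<sigma> 0 = w (\<sigma> 0)"
| "back_comp w \<sigma> (Suc n) = back_comp w \<sigma> n \<circ> w (\<sigma> (- int (Suc n)))"

definition coding_seq ::
  "('e \<Rightarrow> nat) \<Rightarrow> ('e \<Rightarrow> 'a \<Rightarrow> 'a) \<Rightarrow> (nat \<Rightarrow> 'a) \<Rightarrow> (int \<Rightarrow> 'e) \<Rightarrow> nat \<Rightarrow> 'a" where
  "coding_seq ini w xs \<sigma> n = back_comp w \<sigma> n (xs (ini (\<sigma> (- int n))))"

definition coding_dom ::
  "('e \<Rightarrow> nat) \<Rightarrow> ('e \<Rightarrow> nat) \<Rightarrow> ('e \<Rightarrow> 'a::topological_space \<Rightarrow> 'a) \<Rightarrow> (nat \<Rightarrow> 'a) \<Rightarrow>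
    (int \<Rightarrow> 'e) set" where
  "coding_dom ini ter w xs = {\<sigma> \<in> path_space ini ter. convergent (coding_seq ini w xs \<sigma>)}"

definition coding_map ::
  "('e \<Rightarrow> nat) \<Rightarrow> ('e \<Rightarrow> nat) \<Rightarrow> ('e \<Rightarrow> 'a::t2_space \<Rightarrow> 'a) \<Rightarrow> (nat \<Rightarrow> 'a) \<Rightarrow>
    (int \<Rightarrow> 'e) \<Rightarrow> 'a" where
  "coding_map ini ter w xs \<sigma> =
    (if \<sigma> \<in> coding_dom ini ter w xs then lim (coding_seq ini w xs \<sigma>) else xs (ter (\<sigma> 0)))"

definition E_class ::
  "('e \<Rightarrow> nat) \<Rightarrow> ('e \<Rightarrow> nat) \<Rightarrow> ('e \<Rightarrow> 'a::t2_space \<Rightarrow> 'a) \<Rightarrow> ('e \<Rightarrow> 'a \<Rightarrow> real) \<Rightarrow>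
    (nat \<Rightarrow> 'a) \<Rightarrow> (int \<Rightarrow> 'e) measure set" where
  "E_class ini ter w p xs = {\<Lambda>. prob_space \<Lambda> \<and> sets \<Lambda> = sets code_borel \<and> shift_invariant \<Lambda> \<and>
    emeasure \<Lambda> (coding_dom ini ter w xs) = 1 \<and>
    (\<forall>e. AE \<sigma> in \<Lambda>.
      real_cond_exp \<Lambda> past (indicator (cylinder 1 [e])) \<sigma> = p e (coding_map ini ter w xs \<sigma>))}"

definition initial_measure :: "nat set \<Rightarrow> (nat \<Rightarrow> 'a::topological_space) \<Rightarrow> 'a measure" where
  "initial_measure V xs = measure_of UNIV (sets borel)
    (\<lambda>B. (\<Sum>i\<in>V. emeasure (return borel (xs i)) B) / ennreal (real (card V)))"

text \<open>The power \<open>x\<^sup>r\<close> on \<open>[0, \<infinity>]\<close> for \<open>r > 0\<close>.\<close>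

definition ennpow :: "ennreal \<Rightarrow> real \<Rightarrow> ennreal" where
  "ennpow x r = (if x = \<infinity> then \<infinity> else ennreal (enn2real x powr r))"

definition covers :: "(int \<Rightarrow> 'e) set \<Rightarrow> (int \<Rightarrow> (int \<Rightarrow> 'e) set) set" where
  "covers Q = {A. (\<forall>m\<le>0. A m \<in> sets (future m)) \<and> Q \<subseteq> (\<Union>m\<in>{..0}. A m)}"

definition Phi_beta ::
  "((int \<Rightarrow> 'e) set \<Rightarrow> ennreal) \<Rightarrow> real \<Rightarrow> (int \<Rightarrow> 'e) set \<Rightarrow> ennreal" where
  "Phi_beta \<phi> \<beta> Q =
    (INF A\<in>covers Q. ennpow (\<Sum>\<^sub>\<infinity>m\<in>{..0}. ennpow (\<phi> (shift m ` A m)) \<beta>) (1 / \<beta>))"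

text \<open>Both constants are real: the integrals are finite for an invariant measure of a contractive
  system, and the supremum in \<open>Delta\<close> is over a nonempty set bounded by \<open>1\<close> when \<open>t \<ge> 0\<close>.\<close>

definition mean_dist ::
  "nat \<Rightarrow> (nat \<Rightarrow> 'a::metric_space set) \<Rightarrow> (nat \<Rightarrow> 'a) \<Rightarrow> 'a measure \<Rightarrow> real" where
  "mean_dist N K xs \<mu> = (\<Sum>j\<in>{1..N}. LINT x:K j|\<mu>. dist x (xs j))"

definition Delta ::
  "(nat \<Rightarrow> 'a::metric_space set) \<Rightarrow> ('e \<Rightarrow> nat) \<Rightarrow> ('e \<Rightarrow> 'a \<Rightarrow> real) \<Rightarrow> real \<Rightarrow> real" where
  "Delta K ini p t =
    Sup {\<bar>p e x - p e y\<bar> |e x y. x \<in> K (ini e) \<and> y \<in> K (ini e) \<and> dist x y \<le> t}"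

end

theory Submission
  imports Defs
begin

text \<open>It suffices to show \<open>c * M(A)\<^bsup>1/\<beta>\<^esup> \<le> \<phi>\<^sub>0(A)\<close> for \<open>A\<close> in the future \<open>\<sigma>\<close>-algebra, because \<open>M\<close> is
  shift invariant: the \<open>\<beta>\<close>-th powers then add up to at least \<open>c\<^sup>\<beta> * M(Q)\<close> over every cover of \<open>Q\<close>.
  By approximation, \<open>A\<close> may be taken as a union of cylinders of length \<open>n\<close>. The likelihood ratio of a path
  started at \<open>x\<close> and at the base point of the cell of \<open>x\<close> is at most the exponential of \<open>1/\<delta>\<close> times the sum
  over \<open>k < n\<close> of the differences of the transition probabilities along the two orbits. Such a difference
  is at most \<open>\<Delta>(a\<^bsup>(1-q)k\<^esup> C)\<close> unless the orbits are further than \<open>a\<^bsup>(1-q)k\<^esup> C\<close> apart, which by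
  contractivity and Markov's inequality has probability at most \<open>r\<^sup>k\<close>, where \<open>r = a\<^sup>q\<close>. With \<open>b = M(A)\<close>, the
  mean over \<open>A\<close> of the logarithm of the ratio thus costs
  \<open>\<Sum>k. min b (r\<^sup>k) \<le> b (log\<^sub>r b + 1/(1-r))\<close>, and \<open>q\<close> is chosen such that Jensen's inequality turns
  the term \<open>log\<^sub>r b\<close> into the passage from \<open>b\<close> to \<open>b\<^bsup>1/\<beta>\<^esup>\<close>.\<close>

section \<open>Path measures\<close>

lemma sets_future: "sets (future m) = sigma_sets UNIV {cylinder m es |es. es \<noteq> []}"
  by (simp add: future_def)

lemma space_future [simp]: "space (future m) = UNIV"
  by (simp add: future_def space_measure_of_conv)

lemma cylinder_in_future: "es \<noteq> [] \<Longrightarrow> cylinder m es \<in> sets (future m)"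
  by (auto simp: sets_future)

text \<open>Both words start at position \<open>m\<close>: either the shorter is a prefix of the
  longer and the cylinders are nested, or some letter differs and they are disjoint.\<close>

lemma cylinder_Int:
  "cylinder m es \<inter> cylinder m fs \<in> {{}, cylinder m es, cylinder m fs}"
proof -
  have aux: "cylinder m es \<inter> cylinder m fs \<in> {{}, cylinder m fs}" if le: "length es \<le> length fs"
    for es fs :: "'e list"
  proof (cases "take (length es) fs = es")
    case True
    then have "es ! k = fs ! k" if "k < length es" for k
      using that by (metis nth_take)
    then have "cylinder m fs \<subseteq> cylinder m es"
      using le by (auto simp: cylinder_def)
    then show ?thesis by auto
  next
    case False
    then obtain k where "k < length es" "fs ! k \<noteq> es ! k"
      using le by (metis length_take min.absorb2 nth_equalityI nth_take)
    then have "cylinder m es \<inter> cylinder m fs = {}"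
      using le by (auto simp: cylinder_def)
    then show ?thesis by simp
  qed
  show ?thesis
    using aux[of es fs] aux[of fs es] by (cases "length es \<le> length fs") (auto simp: Int_commute)
qed

text \<open>The empty set is adjoined because disjoint cylinders would otherwise lead out of the
  class.\<close>

lemma Int_stable_cylinders: "Int_stable (insert {} {cylinder m es |es. es \<noteq> []})"
proof (rule Int_stableI)
  fix A B :: "(int \<Rightarrow> 'e) set" assume "A \<in> insert {} {cylinder m es |es. es \<noteq> []}" "B \<in> insert {} {cylinder m es |es. es \<noteq> []}"
  then show "A \<inter> B \<in> insert {} {cylinder m es |es. es \<noteq> []}"
  proof (elim insertE CollectE exE conjE)
    fix es fs :: "'e list"
    assume "A = cylinder m es" "es \<noteq> []" "B = cylinder m fs" "fs \<noteq> []"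
    then show ?thesis using cylinder_Int[of m es fs] by fastforce
  qed simp_all
qed

lemma sets_future_insert: "sets (future m) = sigma_sets UNIV (insert {} {cylinder m es |es. es \<noteq> []})"
  unfolding sets_future
  by (intro antisym sigma_sets_mono sigma_sets_mono') (auto intro: sigma_sets.Empty)

lemma UN_cylinder_singleton: "(\<Union>e. cylinder m [e]) = UNIV"
  by (auto simp: cylinder_def)

lemma future_measure_eqI:
  fixes P P' :: "(int \<Rightarrow> 'e::finite) measure"
  assumes "prob_space P" "sets P = sets (future m)" "prob_space P'" "sets P' = sets (future m)"
    and eq: "\<And>es. es \<noteq> [] \<Longrightarrow> measure P (cylinder m es) = measure P' (cylinder m es)"
  shows "P = P'"
proof (rule measure_eqI_generator_eq_countable[OF Int_stable_cylinders[of m], where \<Omega>=UNIV])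
  interpret P: prob_space P by fact
  interpret P': prob_space P' by fact
  show "emeasure P X = emeasure P' X" if "X \<in> insert {} {cylinder m es |es. es \<noteq> []}" for X
    using that eq by (auto simp: P.emeasure_eq_measure P'.emeasure_eq_measure)
  \<comment> \<open>The generator omits the cylinder of the empty word, so the whole space is
    covered by the one-letter cylinders instead, finitely many since the edge type is
    finite.\<close>
  show "range (\<lambda>e. cylinder m [e]) \<subseteq> insert {} {cylinder m es |es. es \<noteq> []}"
    by auto
qed (use assms UN_cylinder_singleton[of m] in
      \<open>auto simp: sets_future_insert prob_space_def finite_measure.emeasure_finite\<close>)

context markov_system begin

lemma cell_ex: "\<exists>j\<in>{1..N}. x \<in> K j"
  using cell_cover by blast

lemma cell_unique: "x \<in> K i \<Longrightarrow> x \<in> K j \<Longrightarrow> i \<in> {1..N} \<Longrightarrow> j \<in> {1..N} \<Longrightarrow> i = j"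
  using cell_disjoint by (fastforce simp: disjoint_family_on_def)

lemma p_nonneg [simp]: "0 \<le> p e x"
  using p_range[of e x] by simp

lemma p_le_1: "p e x \<le> 1"
  using p_range[of e x] by simp

text \<open>Edges that leave another cell have probability 0 at \<open>x\<close>. This lets the
  recursions along paths sum over all edges.\<close>

lemma sum_ini: "j \<in> {1..N} \<Longrightarrow> x \<in> K j \<Longrightarrow> (\<Sum>e | ini e = j. p e x * h e) = (\<Sum>e\<in>UNIV. p e x * h e)"
  using cell_unique[OF _ _ ini_vertex] by (intro sum.mono_neutral_left) (auto intro!: p_outside)

lemma p_sum_UNIV: "(\<Sum>e\<in>UNIV. p e x) = 1"
proof -
  obtain j where "j \<in> {1..N}" "x \<in> K j" using cell_ex by blast
  then show ?thesis using sum_ini[of j x "\<lambda>_. 1"] p_sum[of j x] by simp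
qed

lemma path_prob_nonneg: "0 \<le> path_prob w p x es"
  by (induction es arbitrary: x) auto

lemma path_prob_le_1: "path_prob w p x es \<le> 1"
  by (induction es arbitrary: x) (auto intro!: mult_le_one simp: p_le_1 path_prob_nonneg)

section \<open>Existence and uniqueness of the path measures\<close>

definition edge_pmf :: "'a \<Rightarrow> 'e pmf" where
  "edge_pmf x = embed_pmf (\<lambda>e. p e x)"

lemma pmf_edge_pmf: "pmf (edge_pmf x) e = p e x"
  unfolding edge_pmf_def
  by (rule pmf_embed_pmf) (auto simp: nn_integral_count_space_finite sum_ennreal p_sum_UNIV)

text \<open>The chain is driven by a stream of independent random functions, each of which chooses
  an edge for every point independently; thus no measurability in the point is involved.\<close>

definition noise :: "('a \<Rightarrow> 'e) measure" where
  "noise = (\<Pi>\<^sub>M x\<in>UNIV. measure_pmf (edge_pmf x))"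

primrec run :: "nat \<Rightarrow> 'a \<Rightarrow> ('a \<Rightarrow> 'e) stream \<Rightarrow> 'e" where
  "run 0 x s = shd s x"
| "run (Suc n) x s = run n (w (shd s x) x) (stl s)"

lemma space_noise [simp]: "space noise = UNIV"
  by (auto simp: noise_def space_PiM)

lemma prob_space_noise: "prob_space noise"
  unfolding noise_def by (intro prob_space_PiM measure_pmf.prob_space_axioms)

lemma measurable_noise_component: "(\<lambda>u. u x) \<in> noise \<rightarrow>\<^sub>M count_space UNIV"
proof -
  have "(\<lambda>u. u x) \<in> noise \<rightarrow>\<^sub>M measure_pmf (edge_pmf x)"
    unfolding noise_def by (rule measurable_component_singleton) simp
  then show ?thesis by (simp cong: measurable_cong_sets)
qed

lemma space_noise_stream [simp]: "space (stream_space noise) = UNIV"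
  by (simp add: space_stream_space)

lemma measurable_run: "run n x \<in> stream_space noise \<rightarrow>\<^sub>M count_space UNIV"
proof (induction n arbitrary: x)
  case 0
  show ?case
    using measurable_compose[OF measurable_shd measurable_noise_component] by (simp cong: measurable_cong)
next
  case (Suc n)
  have "(\<lambda>s. run n (w (shd s x) x) (stl s)) \<in> stream_space noise \<rightarrow>\<^sub>M count_space UNIV"
  \<comment> \<open>The next position depends on the stream only through the edge
    \<open>shd s x\<close>. Splitting over the finitely many values of this edge leaves a run from a
    fixed point.\<close>
  proof (rule measurable_compose_countable'[where g="\<lambda>s. shd s x" and I=UNIV])
    show "(\<lambda>s. shd s x) \<in> stream_space noise \<rightarrow>\<^sub>M count_space UNIV"
      by (rule measurable_compose[OF measurable_shd measurable_noise_component])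
    show "(\<lambda>s. run n (w e x) (stl s)) \<in> stream_space noise \<rightarrow>\<^sub>M count_space UNIV" for e
      by (rule measurable_compose[OF measurable_stl Suc])
  qed (simp add: countable_finite)
  then show ?case by (simp cong: measurable_cong)
qed

lemma run_event_measurable: "{s. \<forall>k<length es. run k x s = es ! k} \<in> sets (stream_space noise)"
proof -
  have "(\<lambda>s. run k x s) -` {es ! k} \<inter> space (stream_space noise) \<in> sets (stream_space noise)" for k
    by (rule measurable_sets[OF measurable_run]) simp
  then have *: "{s. run k x s = es ! k} \<in> sets (stream_space noise)" for k
    by (simp add: vimage_def)
  have "{s\<in>space (stream_space noise). \<forall>k\<in>{..<length es}. run k x s = es ! k} \<in> sets (stream_space noise)"
    by (rule sets.sets_Collect_finite_All) (use * in auto)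
  then show ?thesis by (simp add: Ball_def)
qed

lemma noise_component_prob: "emeasure noise {u. u x = e} = ennreal (p e x)"
proof -
  have "emeasure noise {u. u x = e} = emeasure (distr noise (measure_pmf (edge_pmf x)) (\<lambda>u. u x)) {e}"
    using measurable_noise_component[of x] by (subst emeasure_distr) (auto simp: vimage_def cong: measurable_cong_sets)
  also have "distr noise (measure_pmf (edge_pmf x)) (\<lambda>u. u x) = measure_pmf (edge_pmf x)"
    unfolding noise_def by (rule distr_PiM_component) (auto simp: measure_pmf.prob_space_axioms)
  finally show ?thesis by (simp add: emeasure_pmf_single pmf_edge_pmf)
qed

text \<open>The head of the stream is independent of its tail: the head selects the first edge with
  probability \<open>p e x\<close>, and the tail drives the run from \<open>w e x\<close>.\<close>

lemma run_prob:
  "emeasure (stream_space noise) {s. \<forall>k<length es. run k x s = es ! k} = ennreal (path_prob w p x es)"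
proof (induction es arbitrary: x)
  case Nil
  interpret prob_space "stream_space noise"
    using prob_space.prob_space_stream_space[OF prob_space_noise] .
  show ?case using emeasure_space_1 by simp
next
  case (Cons e es)
  interpret noise: prob_space noise by (rule prob_space_noise)
  have split: "(\<forall>k<length (e # es). run k x (u ## s) = (e # es) ! k) \<longleftrightarrow>
      u x = e \<and> (\<forall>k<length es. run k (w e x) s = es ! k)" for u s
    unfolding length_Cons All_less_Suc2 by auto
  have "emeasure (stream_space noise) {s. \<forall>k<length (e # es). run k x s = (e # es) ! k} =
    (\<integral>\<^sup>+u. emeasure (stream_space noise) {s. u x = e \<and> (\<forall>k<length es. run k (w e x) s = es ! k)} \<partial>noise)"
    by (subst noise.emeasure_stream_space[OF run_event_measurable]) (simp only: mem_Collect_eq split space_noise_stream UNIV_I simp_thms)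
  also have "\<dots> = (\<integral>\<^sup>+u. ennreal (path_prob w p (w e x) es) * indicator {u. u x = e} u \<partial>noise)"
    by (intro nn_integral_cong) (auto simp: Cons split: split_indicator)
  also have "\<dots> = ennreal (path_prob w p (w e x) es) * emeasure noise {u. u x = e}"
    by (subst nn_integral_cmult_indicator)
       (use measurable_sets[OF measurable_noise_component, of "{e}" x] in \<open>auto simp: vimage_def\<close>)
  finally show ?case
    by (simp add: noise_component_prob ennreal_mult' mult.commute)
qed

lemma path_measure_exists:
  "\<exists>P. prob_space P \<and> sets P = sets (future m) \<and>
    (\<forall>es. es \<noteq> [] \<longrightarrow> measure P (cylinder m es) = path_prob w p x es)"
proof -
  interpret S: prob_space "stream_space noise"
    using prob_space.prob_space_stream_space[OF prob_space_noise] .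
  \<comment> \<open>The run is written onto the positions from \<open>m\<close> on. For
    \<open>i < m\<close> the truncating \<open>nat\<close> yields time 0; cylinders at
    \<open>m\<close> do not see these coordinates.\<close>
  define f where "f s = (\<lambda>i. run (nat (i - m)) x s)" for s
  have pre: "f -` cylinder m es = {s. \<forall>k<length es. run k x s = es ! k}" for es
    by (auto simp: f_def cylinder_def)
  have f: "f \<in> stream_space noise \<rightarrow>\<^sub>M future m"
    unfolding future_def by (rule measurable_measure_of) (auto simp: pre run_event_measurable)
  have "measure (distr (stream_space noise) (future m) f) (cylinder m es) = path_prob w p x es"
    if "es \<noteq> []" for es
    using f that
    by (simp add: measure_distr cylinder_in_future pre) (simp add: measure_def run_prob path_prob_nonneg)
  then show ?thesis
    by (intro exI[of _ "distr (stream_space noise) (future m) f"]) (auto intro: S.prob_space_distr f)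
qed

text \<open>Existence and uniqueness together make the definite description in
  \<open>path_measure\<close> denote the measure it describes.\<close>

lemma path_measure:
  shows prob_space_path_measure: "prob_space (path_measure w p m x)"
    and sets_path_measure: "sets (path_measure w p m x) = sets (future m)"
    and measure_path_measure_cylinder:
      "es \<noteq> [] \<Longrightarrow> measure (path_measure w p m x) (cylinder m es) = path_prob w p x es"
proof -
  have "\<exists>!P. prob_space P \<and> sets P = sets (future m) \<and>
    (\<forall>es. es \<noteq> [] \<longrightarrow> measure P (cylinder m es) = path_prob w p x es)"
  proof (rule ex_ex1I[OF path_measure_exists])
    fix P P' :: "(int \<Rightarrow> 'e) measure"
    assume P: "prob_space P \<and> sets P = sets (future m) \<and>
        (\<forall>es. es \<noteq> [] \<longrightarrow> measure P (cylinder m es) = path_prob w p x es)"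
      and P': "prob_space P' \<and> sets P' = sets (future m) \<and>
        (\<forall>es. es \<noteq> [] \<longrightarrow> measure P' (cylinder m es) = path_prob w p x es)"
    show "P = P'" by (rule future_measure_eqI[of _ m]) (use P P' in auto)
  qed
  from theI'[OF this] show "prob_space (path_measure w p m x)"
    "sets (path_measure w p m x) = sets (future m)"
    "es \<noteq> [] \<Longrightarrow> measure (path_measure w p m x) (cylinder m es) = path_prob w p x es"
    unfolding path_measure_def by blast+
qed

section \<open>Measurable dependence on the starting point\<close>

lemma w_measurable [measurable]: "w e \<in> borel \<rightarrow>\<^sub>M borel"
  by (rule w_borel)

lemma p_measurable [measurable]: "p e \<in> borel_measurable borel"
  by (rule p_borel)

lemma path_prob_measurable [measurable]: "(\<lambda>x. path_prob w p x es) \<in> borel_measurable borel"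
  by (induction es) (auto, measurable)

lemma emeasure_path_measure:
  "emeasure (path_measure w p m x) A = ennreal (measure (path_measure w p m x) A)"
  using prob_space_path_measure by (intro finite_measure.emeasure_eq_measure prob_space.finite_measure)

text \<open>Measurability of the kernel need only be checked on an intersection-stable generator; on
  a cylinder its value is the finite product \<open>path_prob\<close>.\<close>

lemma path_measure_measurable:
  "path_measure w p m \<in> borel \<rightarrow>\<^sub>M prob_algebra (future m)"
proof (rule measurable_prob_algebra_generated[OF sets_future_insert Int_stable_cylinders])
  fix A :: "(int \<Rightarrow> 'e) set" assume "A \<in> insert {} {cylinder m es |es. es \<noteq> []}"
  then consider "A = {}" | es where "A = cylinder m es" "es \<noteq> []" by auto
  then show "(\<lambda>x. emeasure (path_measure w p m x) A) \<in> borel_measurable borel"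
  proof cases
    case 2
    have "emeasure (path_measure w p m x) A = ennreal (path_prob w p x es)" for x
      using 2 measure_path_measure_cylinder[of es m x]
      by (simp add: emeasure_path_measure)
    then show ?thesis by simp
  qed simp
qed (auto simp: prob_space_path_measure sets_path_measure)

lemma emeasure_path_measure_measurable:
  assumes "A \<in> sets (future m)"
  shows "(\<lambda>x. emeasure (path_measure w p m x) A) \<in> borel_measurable borel"
  by (rule measurable_emeasure_kernel[OF measurable_prob_algebraD[OF path_measure_measurable] assms])

end

section \<open>The initial distribution\<close>

lemma nn_integral_uniform_count_measure:
  assumes "finite V"
  shows "(\<integral>\<^sup>+i. f i \<partial>uniform_count_measure V) = (\<Sum>i\<in>V. f i) / of_nat (card V)"
  using assms
proof (cases "V = {}")
  case False
  have "(\<integral>\<^sup>+i. f i \<partial>uniform_count_measure V) = (\<Sum>i\<in>V. f i * ennreal (1 / real (card V)))"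
    using assms by (simp add: uniform_count_measure_def nn_integral_point_measure_finite mult.commute)
  also have "\<dots> = (\<Sum>i\<in>V. f i) * ennreal (1 / real (card V))"
    by (rule sum_distrib_right[symmetric])
  finally show ?thesis
    using False assms
    by (simp add: divide_ennreal_def ennreal_of_nat_eq_real_of_nat inverse_ennreal card_gt_0_iff inverse_eq_divide)
qed (simp add: uniform_count_measure_def nn_integral_point_measure_finite)

text \<open>Recognising a push-forward shows that the set function handed to
  \<open>measure_of\<close> is a measure, and reduces integrals against it to finite
  averages.\<close>

lemma initial_measure_eq:
  assumes "finite V" "V \<noteq> {}"
  shows "initial_measure V xs = distr (uniform_count_measure V) borel xs"
proof -
  have "(\<Sum>i\<in>V. emeasure (return borel (xs i)) B) / ennreal (real (card V)) =
      emeasure (distr (uniform_count_measure V) borel xs) B" if "B \<in> sigma_sets UNIV (sets borel)" for B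
  proof -
    have B: "B \<in> sets borel" using that by (metis sets.sigma_sets_eq space_borel)
    have "emeasure (distr (uniform_count_measure V) borel xs) B
        = emeasure (uniform_count_measure V) (xs -` B \<inter> V)"
      using B by (simp add: emeasure_distr space_uniform_count_measure)
    also have "\<dots> = ennreal (real (card (xs -` B \<inter> V)) / real (card V))"
      using assms by (subst emeasure_uniform_count_measure) (auto simp: ennreal_of_nat_eq_real_of_nat)
    also have "real (card (xs -` B \<inter> V)) = (\<Sum>i\<in>V. indicator B (xs i))"
      using assms by (simp add: indicator_def sum.If_cases Int_def vimage_def conj_commute)
    finally show ?thesis using B assms
      by (simp add: divide_ennreal[symmetric] sum_nonneg card_gt_0_iff sum_ennreal[symmetric] ennreal_indicator
          flip: ennreal_of_nat_eq_real_of_nat)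
  qed
  then have "initial_measure V xs =
      measure_of UNIV (sets borel) (emeasure (distr (uniform_count_measure V) borel xs))"
    unfolding initial_measure_def by (intro measure_of_eq) auto
  also have "\<dots> = distr (uniform_count_measure V) borel xs"
    using measure_of_of_measure[of "distr (uniform_count_measure V) borel xs"] by simp
  finally show ?thesis .
qed

lemma (in markov_system) Phi_0_initial_measure:
  assumes V: "finite V" "V \<noteq> {}" and A: "A \<in> sets (future 0)"
  shows "Phi_0 w p (initial_measure V xs) A =
    ennreal ((\<Sum>i\<in>V. measure (path_measure w p 0 (xs i)) A) / real (card V))"
proof -
  have "Phi_0 w p (initial_measure V xs) A =
     (\<integral>\<^sup>+i. emeasure (path_measure w p 0 (xs i)) A \<partial>uniform_count_measure V)"
    unfolding Phi_0_def initial_measure_eq[OF V]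
    using emeasure_path_measure_measurable[OF A] by (subst nn_integral_distr) auto
  also have "\<dots> = (\<Sum>i\<in>V. emeasure (path_measure w p 0 (xs i)) A) / card V"
    using V by (simp add: nn_integral_uniform_count_measure)
  finally show ?thesis using V unfolding emeasure_path_measure
    by (simp add: sum_ennreal divide_ennreal sum_nonneg card_gt_0_iff ennreal_of_nat_eq_real_of_nat)
qed

section \<open>Approximation by cylinders\<close>

text \<open>The sets that can be approximated form a sigma-algebra. A common approximant for a
  finite family is needed because the inequality to be transferred involves several measures at
  once.\<close>

lemma algebra_approx:
  assumes G: "algebra \<Omega> G" and fin: "finite \<M>"
    and \<M>: "\<And>\<mu>. \<mu> \<in> \<M> \<Longrightarrow> finite_measure \<mu>" "\<And>\<mu>. \<mu> \<in> \<M> \<Longrightarrow> sigma_sets \<Omega> G \<subseteq> sets \<mu>"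
    and A: "A \<in> sigma_sets \<Omega> G" and "0 < \<epsilon>"
  shows "\<exists>B\<in>G. \<forall>\<mu>\<in>\<M>. measure \<mu> (sym_diff A B) < \<epsilon>"
  using A \<open>0 < \<epsilon>\<close>
proof (induction arbitrary: \<epsilon>)
  interpret G: algebra \<Omega> G by fact
  interpret S: sigma_algebra \<Omega> "sigma_sets \<Omega> G" by (rule sigma_algebra_sigma_sets) (rule G.space_closed)
  {
    case (Basic A)
    then show ?case by (intro bexI[of _ A]) auto
  next
    case Empty
    then show ?case by (intro bexI[of _ "{}"]) auto
  next
    case (Compl A)
    then obtain B where B: "B \<in> G" "\<forall>\<mu>\<in>\<M>. measure \<mu> (sym_diff A B) < \<epsilon>" by blast
    have "A \<subseteq> \<Omega>" "B \<subseteq> \<Omega>"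
      using Compl.hyps B(1) S.space_closed G.space_closed by auto
    then have "sym_diff (\<Omega> - A) (\<Omega> - B) = sym_diff A B" by auto
    with B show ?case by (intro bexI[of _ "\<Omega> - B"]) auto
  next
    case (Union A)
    \<comment> \<open>By continuity from below, a finite part of the union catches all but half of
      the error; finiteness of the family then gives one \<open>n\<close> for all measures.\<close>
    have "eventually (\<lambda>n. measure \<mu> (\<Union>i. A i) - \<epsilon> / 2 < measure \<mu> (\<Union>i<n. A i)) sequentially"
      if "\<mu> \<in> \<M>" for \<mu>
    proof -
      interpret finite_measure \<mu> using that \<M> by blast
      have "A i \<in> sets \<mu>" for i using Union.hyps that \<M> by blast
      then have "(\<lambda>n. measure \<mu> (\<Union>i<n. A i)) \<longlonglongrightarrow> measure \<mu> (\<Union>n. \<Union>i<n. A i)"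
        by (intro finite_Lim_measure_incseq) (auto simp: incseq_def intro: less_le_trans)
      also have "(\<Union>n. \<Union>i<n. A i) = (\<Union>i. A i)" by auto
      finally show ?thesis using Union.prems by (intro order_tendstoD(1)) auto
    qed
    then have "eventually (\<lambda>n. \<forall>\<mu>\<in>\<M>. measure \<mu> (\<Union>i. A i) - \<epsilon> / 2 < measure \<mu> (\<Union>i<n. A i)) sequentially"
      using fin by (simp add: eventually_ball_finite)
    then obtain n where n: "\<And>\<mu>. \<mu> \<in> \<M> \<Longrightarrow> measure \<mu> (\<Union>i. A i) - \<epsilon> / 2 < measure \<mu> (\<Union>i<n. A i)"
      by (auto simp: eventually_sequentially)
    \<comment> \<open>The other half of the error is shared among \<open>n\<close> sets; dividing by
      \<open>Suc n\<close> also covers \<open>n = 0\<close>.\<close>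
    have "\<forall>i. \<exists>B\<in>G. \<forall>\<mu>\<in>\<M>. measure \<mu> (sym_diff (A i) B) < \<epsilon> / (2 * Suc n)"
      using Union by (auto simp del: of_nat_Suc)
    then obtain B where B: "\<And>i. B i \<in> G" "\<And>i \<mu>. \<mu> \<in> \<M> \<Longrightarrow> measure \<mu> (sym_diff (A i) (B i)) < \<epsilon> / (2 * Suc n)"
      by metis
    show ?case
    proof (intro bexI ballI)
      show "(\<Union>i<n. B i) \<in> G" using B by auto
      fix \<mu> assume \<mu>: "\<mu> \<in> \<M>"
      interpret finite_measure \<mu> using \<mu> \<M> by blast
      have meas: "A i \<in> sets \<mu>" "B i \<in> sets \<mu>" for i using Union.hyps B(1) \<mu> \<M>(2) by blast+
      have "sym_diff (\<Union>i. A i) (\<Union>i<n. B i)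
          \<subseteq> ((\<Union>i. A i) - (\<Union>i<n. A i)) \<union> (\<Union>i<n. sym_diff (A i) (B i))"
        by fast
      then have "measure \<mu> (sym_diff (\<Union>i. A i) (\<Union>i<n. B i))
          \<le> measure \<mu> (((\<Union>i. A i) - (\<Union>i<n. A i)) \<union> (\<Union>i<n. sym_diff (A i) (B i)))"
        using meas by (intro finite_measure_mono sets.Un sets.Diff sets.countable_UN sets.finite_UN) auto
      also have "\<dots> \<le> measure \<mu> ((\<Union>i. A i) - (\<Union>i<n. A i)) + measure \<mu> (\<Union>i<n. sym_diff (A i) (B i))"
        using meas by (intro measure_Un_le) auto
      also have "measure \<mu> ((\<Union>i. A i) - (\<Union>i<n. A i)) = measure \<mu> (\<Union>i. A i) - measure \<mu> (\<Union>i<n. A i)"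
        using meas by (intro finite_measure_Diff) auto
      also have "measure \<mu> (\<Union>i<n. sym_diff (A i) (B i)) \<le> (\<Sum>i<n. measure \<mu> (sym_diff (A i) (B i)))"
        using meas by (intro measure_UNION_le) auto
      also have "\<dots> \<le> (\<Sum>i<n. \<epsilon> / (2 * Suc n))"
        using B(2)[OF \<mu>] by (intro sum_mono less_imp_le) auto
      also have "\<dots> \<le> \<epsilon> / 2" using Union.prems by (simp add: field_simps)
      finally show "measure \<mu> (sym_diff (\<Union>i. A i) (\<Union>i<n. B i)) < \<epsilon>"
        using n[OF \<mu>] by simp
    qed
  }
qed

section \<open>Events depending on finitely many coordinates\<close>

definition word :: "nat \<Rightarrow> (int \<Rightarrow> 'e) \<Rightarrow> 'e list" where
  "word n \<sigma> = map (\<lambda>k. \<sigma> (int k)) [0..<n]"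

text \<open>The condition \<open>n > 0\<close> matches the exclusion of the empty word from the
  generators of \<open>future 0\<close>.\<close>

definition word_sets :: "(int \<Rightarrow> 'e) set set" where
  "word_sets = {word n -` L |n L. n > 0}"

lemma length_word [simp]: "length (word n \<sigma>) = n"
  by (simp add: word_def)

lemma take_word: "n \<le> m \<Longrightarrow> take n (word m \<sigma>) = word n \<sigma>"
  by (simp add: word_def take_map)

lemma word_eq_iff: "word n \<sigma> = es \<longleftrightarrow> length es = n \<and> \<sigma> \<in> cylinder 0 es"
  by (auto simp: cylinder_def word_def list_eq_iff_nth_eq)

lemma word_vimage: "word n -` L = (\<Union>es\<in>{es\<in>L. length es = n}. cylinder 0 es)"
proof (intro set_eqI)
  fix \<sigma> :: "int \<Rightarrow> 'a"
  have "\<sigma> \<in> word n -` L \<longleftrightarrow> (\<exists>es\<in>L. word n \<sigma> = es)" by simp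
  then show "\<sigma> \<in> word n -` L \<longleftrightarrow> \<sigma> \<in> (\<Union>es\<in>{es\<in>L. length es = n}. cylinder 0 es)"
    unfolding word_eq_iff by blast
qed

lemma algebra_word_sets: "algebra UNIV (word_sets :: (int \<Rightarrow> 'e) set set)"
  unfolding algebra_iff_Un
proof (intro conjI ballI)
  show "{} \<in> (word_sets :: (int \<Rightarrow> 'e) set set)"
    unfolding word_sets_def by (auto intro!: exI[of _ 1] exI[of _ "{}"])
next
  fix A :: "(int \<Rightarrow> 'e) set" assume "A \<in> word_sets"
  then obtain n L where "n > 0" "A = word n -` L" by (auto simp: word_sets_def)
  then show "UNIV - A \<in> word_sets"
    unfolding word_sets_def by (auto intro!: exI[of _ n] exI[of _ "-L"])
next
  fix A B :: "(int \<Rightarrow> 'e) set" assume "A \<in> word_sets" "B \<in> word_sets"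
  then obtain n L n' L' where *: "n > 0" "A = word n -` L" "n' > 0" "B = word n' -` L'"
    by (auto simp: word_sets_def)
  \<comment> \<open>Events of two different lengths become events of the larger length by looking at
    prefixes.\<close>
  have "A \<union> B = word (max n n') -` {es. take n es \<in> L \<or> take n' es \<in> L'}"
    by (auto simp: * take_word)
  moreover have "0 < max n n'" using * by simp
  ultimately show "A \<union> B \<in> word_sets" unfolding word_sets_def by blast
qed auto

lemma sigma_sets_word_sets:
  "sigma_sets UNIV (word_sets :: (int \<Rightarrow> 'e::finite) set set) = sets (future 0)"
  unfolding sets_future
proof (rule sigma_sets_eqI)
  fix A :: "(int \<Rightarrow> 'e) set" assume "A \<in> word_sets"
  then obtain n L where A: "n > 0" "A = word n -` L" by (auto simp: word_sets_def)
  have "finite {es\<in>L. length es = n}"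
    by (rule finite_subset[OF _ finite_lists_length_eq[of UNIV n]]) auto
  then have "(\<Union>es\<in>{es\<in>L. length es = n}. cylinder 0 es) \<in> sets (future 0)"
    using A by (intro sets.finite_UN cylinder_in_future) auto
  then show "A \<in> sigma_sets UNIV {cylinder 0 es |es. es \<noteq> []}"
    unfolding A word_vimage sets_future .
next
  fix A :: "(int \<Rightarrow> 'e) set" assume "A \<in> {cylinder 0 es |es. es \<noteq> []}"
  then obtain es where "es \<noteq> []" "A = cylinder 0 es" by auto
  then have "A = word (length es) -` {es}" "length es > 0"
    by (auto simp: word_eq_iff)
  then show "A \<in> sigma_sets UNIV word_sets" unfolding word_sets_def by blast
qed

lemma measure_word_vimage:
  fixes P :: "(int \<Rightarrow> 'e::finite) measure"
  assumes "finite_measure P" "sets (future 0) \<subseteq> sets P" "n > 0"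
  shows "measure P (word n -` L) = (\<Sum>es | es \<in> L \<and> length es = n. measure P (cylinder 0 es))"
proof -
  interpret finite_measure P by fact
  have "finite {es\<in>L. length es = n}"
    by (rule finite_subset[OF _ finite_lists_length_eq[of UNIV n]]) auto
  moreover have "disjoint_family_on (cylinder 0) {es\<in>L. length es = n}"
    by (auto simp: disjoint_family_on_def cylinder_def list_eq_iff_nth_eq)
  moreover have "cylinder 0 es \<in> sets P" if "es \<in> {es\<in>L. length es = n}" for es
    using that assms cylinder_in_future[of es 0] by auto
  ultimately show ?thesis
    unfolding word_vimage by (intro finite_measure_finite_Union) auto
qed

text \<open>Both sides are continuous in the measures of the set, so approximating \<open>A\<close>
  simultaneously for \<open>M\<close> and all \<open>P i\<close> carries the inequality
  over.\<close>

lemma lower_bound_from_words: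
  fixes M :: "(int \<Rightarrow> 'e::finite) measure"
  assumes V: "finite V" and M: "finite_measure M" "sets (future 0) \<subseteq> sets M"
    and P: "\<And>i. i \<in> V \<Longrightarrow> finite_measure (P i)" "\<And>i. i \<in> V \<Longrightarrow> sets (P i) = sets (future 0)"
    and "0 < s"
    and words: "\<And>B. B \<in> word_sets \<Longrightarrow> c * measure M B powr s \<le> (\<Sum>i\<in>V. measure (P i) B)"
    and A: "A \<in> sets (future 0)"
  shows "c * measure M A powr s \<le> (\<Sum>i\<in>V. measure (P i) A)"
proof -
  let ?\<M> = "insert M (P ` V)"
  have fin: "finite_measure \<mu>" and sub: "sigma_sets UNIV word_sets \<subseteq> sets \<mu>" if "\<mu> \<in> ?\<M>" for \<mu>
    using that M P by (auto simp: sigma_sets_word_sets)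
  have "\<exists>B\<in>word_sets. \<forall>\<mu>\<in>?\<M>. measure \<mu> (sym_diff A B) < 1 / real (Suc n)" for n
    using A V by (intro algebra_approx[OF algebra_word_sets]) (auto simp: sigma_sets_word_sets fin M P dest: subsetD[OF M(2)])
  then obtain B where B: "\<And>n. B n \<in> word_sets"
    and small: "\<And>n \<mu>. \<mu> \<in> ?\<M> \<Longrightarrow> measure \<mu> (sym_diff A (B n)) < 1 / real (Suc n)"
    by metis
  have lim: "(\<lambda>n. measure \<mu> (B n)) \<longlonglongrightarrow> measure \<mu> A" if \<mu>: "\<mu> \<in> ?\<M>" for \<mu>
  proof -
    interpret finite_measure \<mu> using fin \<mu> by blast
    have sets: "A \<in> sets \<mu>" "B n \<in> sets \<mu>" for n
      using A B sub[OF \<mu>] by (auto simp: sigma_sets_word_sets[symmetric])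
    have "\<bar>measure \<mu> (B n) - measure \<mu> A\<bar> \<le> 1 / real (Suc n)" for n
    proof -
      have "measure \<mu> (B n) \<le> measure \<mu> (A \<union> sym_diff A (B n))"
        "measure \<mu> A \<le> measure \<mu> (B n \<union> sym_diff A (B n))"
        using sets by (auto intro!: finite_measure_mono)
      moreover have "measure \<mu> (A \<union> sym_diff A (B n)) \<le> measure \<mu> A + measure \<mu> (sym_diff A (B n))"
        "measure \<mu> (B n \<union> sym_diff A (B n)) \<le> measure \<mu> (B n) + measure \<mu> (sym_diff A (B n))"
        using sets by (auto intro!: measure_Un_le)
      ultimately show ?thesis using small[OF \<mu>, of n] by simp
    qed
    then have "(\<lambda>n. measure \<mu> (B n) - measure \<mu> A) \<longlonglongrightarrow> 0"
      by (intro tendsto_rabs_zero_cancel[OF tendsto_sandwich[OF _ _ tendsto_const LIMSEQ_inverse_real_of_nat]])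
         (auto simp: inverse_eq_divide)
    then show ?thesis by (simp add: LIM_zero_iff)
  qed
  \<comment> \<open>Since \<open>0 < s\<close>, the power is continuous at measure 0 as
    well.\<close>
  have "(\<lambda>n. c * measure M (B n) powr s) \<longlonglongrightarrow> c * measure M A powr s"
    using lim[of M] \<open>0 < s\<close> by (intro tendsto_intros tendsto_powr2) auto
  moreover have "(\<lambda>n. \<Sum>i\<in>V. measure (P i) (B n)) \<longlonglongrightarrow> (\<Sum>i\<in>V. measure (P i) A)"
    using lim by (intro tendsto_sum) auto
  ultimately show ?thesis
    by (rule LIMSEQ_le) (use words B in auto)
qed

section \<open>Dini continuity\<close>

lemma modulus_on_mono: "s \<le> t \<Longrightarrow> modulus_on X h s \<le> modulus_on X h t"
  unfolding modulus_on_def by (rule SUP_subset_mono) auto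

text \<open>An integral test on geometric pieces. Between \<open>c * s ^ Suc i\<close> and
  \<open>c * s ^ i\<close> the integrand is at least the modulus at the left end divided by the
  right end; times the length of the piece this is \<open>1 - s\<close> times that modulus.\<close>

lemma dini_summable:
  assumes "dini_continuous_on X h" "0 < s" "s < 1" 
  obtains c where "0 < c" "(\<Sum>i. modulus_on X h (c * s ^ Suc i)) < \<infinity>"
proof -
  from assms obtain c where c: "0 < c"
    and fin: "(\<integral>\<^sup>+t\<in>{0<..c}. modulus_on X h t / ennreal t \<partial>lborel) < \<infinity>"
    unfolding dini_continuous_on_def by blast
  define I where "I i = {c * s ^ Suc i<..c * s ^ i}" for i
  define m where "m i = modulus_on X h (c * s ^ Suc i)" for i
  have disj: "i = j" if "t \<in> I i" "t \<in> I j" for t i j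
  proof -
    have "\<not> i < j" if "t \<in> I i" "t \<in> I j" for i j
    proof
      assume "i < j"
      then have "c * s ^ j \<le> c * s ^ Suc i"
        using assms c by (intro mult_left_mono power_decreasing) auto
      then show False using that by (auto simp: I_def)
    qed
    then show ?thesis using that by (metis linorder_neqE_nat)
  qed
  have le: "(\<Sum>i. m i * ennreal (1 / (c * s ^ i)) * indicator (I i) t)
      \<le> modulus_on X h t / ennreal t * indicator {0<..c} t" for t
  proof (cases "\<exists>i. t \<in> I i")
    case True
    then obtain i where i: "t \<in> I i" by blast
    have "0 < c * s ^ Suc i" using assms c by simp
    moreover have "c * s ^ i \<le> c * 1" using assms c by (intro mult_left_mono power_le_one) auto
    ultimately have t: "0 < t" "t \<le> c" using i unfolding I_def by (auto simp del: power_Suc mult_1_right)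
    have "(\<Sum>i. m i * ennreal (1 / (c * s ^ i)) * indicator (I i) t)
        = (\<Sum>j\<in>{i}. m j * ennreal (1 / (c * s ^ j)) * indicator (I j) t)"
      by (rule suminf_finite) (use disj[OF i] in \<open>auto simp: indicator_def\<close>)
    also have "\<dots> = m i * ennreal (1 / (c * s ^ i))" using i by simp
    also have "\<dots> \<le> modulus_on X h t * ennreal (1 / t)"
    proof -
      have "0 < c * s ^ i" using assms c by simp
      moreover have "c * s ^ Suc i < t" "t \<le> c * s ^ i" using i by (auto simp: I_def)
      ultimately show ?thesis
        unfolding m_def using t
        by (intro mult_mono modulus_on_mono ennreal_leI divide_left_mono) auto
    qed
    also have "\<dots> = modulus_on X h t / ennreal t * indicator {0<..c} t"
      using t by (simp add: divide_ennreal_def inverse_ennreal inverse_eq_divide)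
    finally show ?thesis .
  next
    case False
    then show ?thesis by simp
  qed
  have "ennreal (1 - s) * (\<Sum>i. m i) = (\<Sum>i. m i * ennreal (1 - s))"
    by (simp add: mult.commute)
  also have "\<dots> = (\<Sum>i. m i * ennreal (1 / (c * s ^ i)) * emeasure lborel (I i))"
  proof (intro suminf_cong)
    fix i
    have "c * s ^ Suc i \<le> c * s ^ i"
      using assms c by (intro mult_left_mono power_decreasing) auto
    then have "emeasure lborel (I i) = ennreal (c * s ^ i - c * s ^ Suc i)"
      by (simp add: I_def)
    moreover have "ennreal (1 / (c * s ^ i)) * ennreal (c * s ^ i - c * s ^ Suc i) = ennreal (1 - s)"
      using assms c by (subst ennreal_mult[symmetric]) (auto simp: field_simps mult_left_le_one_le)
    ultimately show "m i * ennreal (1 - s) = m i * ennreal (1 / (c * s ^ i)) * emeasure lborel (I i)"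
      by (simp add: mult.assoc)
  qed
  also have "\<dots> = (\<integral>\<^sup>+t. (\<Sum>i. m i * ennreal (1 / (c * s ^ i)) * indicator (I i) t) \<partial>lborel)"
    by (subst nn_integral_suminf) (auto simp: I_def nn_integral_cmult_indicator)
  also have "\<dots> \<le> (\<integral>\<^sup>+t\<in>{0<..c}. modulus_on X h t / ennreal t \<partial>lborel)"
    by (intro nn_integral_mono le)
  finally have "ennreal (1 - s) * (\<Sum>i. m i) < \<infinity>" using fin by simp
  then have "(\<Sum>i. m i) < \<infinity>"
    using assms by (auto simp: ennreal_mult_less_top less_top)
  then show thesis using that[of c] c by (simp add: m_def)
qed

context markov_system begin

section \<open>Bounds and summability for \<open>Delta\<close>\<close>

lemma osc_le_1: "\<bar>p e x - p e y\<bar> \<le> 1"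
  using p_nonneg[of e x] p_nonneg[of e y] p_le_1[of e x] p_le_1[of e y] by linarith

lemma Delta_upper:
  assumes "x \<in> K (ini e)" "y \<in> K (ini e)" "dist x y \<le> t"
  shows "\<bar>p e x - p e y\<bar> \<le> Delta K ini p t"
  unfolding Delta_def by (rule cSup_upper) (use assms osc_le_1 in \<open>auto intro!: bdd_aboveI[of _ 1]\<close>)

lemma Delta_le:
  assumes "0 \<le> t" and "\<And>e x y. x \<in> K (ini e) \<Longrightarrow> y \<in> K (ini e) \<Longrightarrow> dist x y \<le> t \<Longrightarrow> \<bar>p e x - p e y\<bar> \<le> u"
  shows "Delta K ini p t \<le> u"
  unfolding Delta_def
proof (rule cSup_least)
  obtain x where "x \<in> K (ini undefined)" using cell_nonempty[OF ini_vertex] by blast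
  then show "{\<bar>p e x - p e y\<bar> |e x y. x \<in> K (ini e) \<and> y \<in> K (ini e) \<and> dist x y \<le> t} \<noteq> {}"
    using assms(1) by fastforce
qed (use assms(2) in auto)

lemma Delta_nonneg:
  assumes "0 \<le> t" shows "0 \<le> Delta K ini p t"
proof -
  obtain x where "x \<in> K (ini undefined)" using cell_nonempty[OF ini_vertex] by blast
  from Delta_upper[OF this this, of t] assms show ?thesis by simp
qed

text \<open>Summing over the edges instead of taking their maximum is crude, but preserves
  summability because there are finitely many edges.\<close>

lemma Delta_le_modulus:
  assumes "0 \<le> t"
  shows "ennreal (Delta K ini p t) \<le> (\<Sum>e\<in>UNIV. modulus_on (K (ini e)) (p e) t)"
proof (cases "(\<Sum>e\<in>UNIV. modulus_on (K (ini e)) (p e) t)")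
  case (real r)
  have "Delta K ini p t \<le> r"
  proof (rule Delta_le[OF assms])
    fix e x y assume *: "x \<in> K (ini e)" "y \<in> K (ini e)" "dist x y \<le> t"
    have "ennreal \<bar>p e x - p e y\<bar> \<le> modulus_on (K (ini e)) (p e) t"
      unfolding modulus_on_def by (rule SUP_upper2[of "(x, y)"]) (use * in auto)
    also have "\<dots> \<le> (\<Sum>e\<in>UNIV. modulus_on (K (ini e)) (p e) t)"
      by (rule member_le_sum) auto
    finally show "\<bar>p e x - p e y\<bar> \<le> r" using real by simp
  qed
  then show ?thesis using real by (simp add: ennreal_leI)
next
  case top
  then show ?thesis unfolding top by simp
qed

text \<open>Each edge has its own Dini scale \<open>c e\<close>. From some index on
  \<open>s ^ n * C\<close> lies below the smallest scale, so a tail of the series is dominated by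
  finitely many convergent series.\<close>

lemma Delta_summable:
  assumes dini: "\<And>e. dini_continuous_on (K (ini e)) (p e)" and s: "0 < s" "s < 1" and "0 \<le> C"
  shows "summable (\<lambda>i. Delta K ini p (s ^ i * C))"
proof -
  have "\<forall>e. \<exists>c>0. (\<Sum>i. modulus_on (K (ini e)) (p e) (c * s ^ Suc i)) < \<infinity>"
    using dini_summable[OF dini s] by metis
  then obtain c where c: "\<And>e. 0 < c e" "\<And>e. (\<Sum>i. modulus_on (K (ini e)) (p e) (c e * s ^ Suc i)) < \<infinity>"
    by metis
  define c0 where "c0 = Min (range c)"
  have c0: "0 < c0" "\<And>e. c0 \<le> c e" using c by (auto simp: c0_def)
  have "(\<lambda>n. s ^ n * C) \<longlonglongrightarrow> 0 * C"
    using s by (intro tendsto_mult LIMSEQ_power_zero) auto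
  then have "eventually (\<lambda>n. s ^ n * C < c0) sequentially"
    using c0 by (intro order_tendstoD(2)) auto
  then obtain n where n: "s ^ n * C < c0" by (auto simp: eventually_sequentially)
  have "ennreal (Delta K ini p (s ^ (i + Suc n) * C)) \<le> (\<Sum>e\<in>UNIV. modulus_on (K (ini e)) (p e) (c e * s ^ Suc i))" for i
  proof -
    have "s ^ (i + Suc n) * C = s ^ Suc i * (s ^ n * C)" by (simp add: power_add)
    also have "\<dots> \<le> s ^ Suc i * c0" using n s by (intro mult_left_mono) auto
    finally have le: "s ^ (i + Suc n) * C \<le> s ^ Suc i * c0" .
    have "s ^ (i + Suc n) * C \<le> c e * s ^ Suc i" for e
      using order_trans[OF le mult_left_mono[OF c0(2)[of e], of "s ^ Suc i"]] s
      by (simp add: mult.commute del: power_Suc add_Suc_right)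
    then have "(\<Sum>e\<in>UNIV. modulus_on (K (ini e)) (p e) (s ^ (i + Suc n) * C))
        \<le> (\<Sum>e\<in>UNIV. modulus_on (K (ini e)) (p e) (c e * s ^ Suc i))"
      by (intro sum_mono modulus_on_mono)
    then show ?thesis
      using Delta_le_modulus[of "s ^ (i + Suc n) * C"] s \<open>0 \<le> C\<close> by (simp del: power_Suc add_Suc_right)
  qed
  then have "(\<Sum>i. ennreal (Delta K ini p (s ^ (i + Suc n) * C)))
      \<le> (\<Sum>i. \<Sum>e\<in>UNIV. modulus_on (K (ini e)) (p e) (c e * s ^ Suc i))"
    by (intro suminf_le) auto
  also have "\<dots> = (\<Sum>e\<in>UNIV. \<Sum>i. modulus_on (K (ini e)) (p e) (c e * s ^ Suc i))"
    by (rule suminf_sum) auto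
  also have "\<dots> < \<infinity>" using c(2) by (simp add: less_top del: power_Suc)
  finally have "summable (\<lambda>i. Delta K ini p (s ^ (i + Suc n) * C))"
    using s \<open>0 \<le> C\<close> by (intro summable_suminf_not_top Delta_nonneg) auto
  then show ?thesis using summable_iff_shift[of "\<lambda>i. Delta K ini p (s ^ i * C)" "Suc n"] by simp
qed

end

section \<open>The coding map\<close>

lemma space_code_borel [simp]: "space code_borel = UNIV"
  by (simp add: code_borel_def space_measure_of_conv)

lemma code_coordinate_measurable [measurable]: "(\<lambda>\<sigma>. \<sigma> i) \<in> code_borel \<rightarrow>\<^sub>M count_space UNIV"
proof (rule measurableI)
  fix A :: "'e set"
  have "openin (product_topology (\<lambda>_. discrete_topology UNIV) UNIV)
      {\<sigma> \<in> topspace (product_topology (\<lambda>_::int. discrete_topology (UNIV::'e set)) UNIV). \<sigma> i \<in> A}"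
    by (rule openin_continuous_map_preimage[OF continuous_map_product_projection]) auto
  then show "(\<lambda>\<sigma>. \<sigma> i) -` A \<inter> space code_borel \<in> sets code_borel"
    by (auto simp: code_borel_def vimage_def)
qed simp

lemma cylinder_in_code_borel: "cylinder m es \<in> sets code_borel"
proof -
  have "(\<lambda>\<sigma>. \<sigma> (m + int k)) -` {es ! k} \<inter> space code_borel \<in> sets code_borel" for k
    by (rule measurable_sets[OF code_coordinate_measurable]) simp
  then have *: "{\<sigma>. \<sigma> (m + int k) = es ! k} \<in> sets code_borel" for k
    by (simp add: vimage_def)
  have "{\<sigma>\<in>space code_borel. \<forall>k\<in>{..<length es}. \<sigma> (m + int k) = es ! k} \<in> sets code_borel"
    by (rule sets.sets_Collect_finite_All) (use * in auto)
  then show ?thesis by (simp add: cylinder_def Ball_def)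
qed

lemma sets_future_subset: "sets (future m :: (int \<Rightarrow> 'a) measure) \<subseteq> sets code_borel"
proof -
  have "sigma_sets (space code_borel) {cylinder m es |es :: 'a list. es \<noteq> []} \<subseteq> sets code_borel"
    by (rule sets.sigma_sets_subset) (auto intro: cylinder_in_code_borel)
  then show ?thesis by (simp add: sets_future)
qed

lemma subalgebra_past: "sets M = sets code_borel \<Longrightarrow> subalgebra M past"
proof -
  assume M: "sets M = sets code_borel"
  have "sigma_sets (space code_borel) {cylinder m es |(m::int) es::'a list. es \<noteq> [] \<and> m + int (length es) = 1} \<subseteq> sets code_borel"
    by (rule sets.sigma_sets_subset) (auto intro: cylinder_in_code_borel)
  then show ?thesis
    using M sets_eq_imp_space_eq[OF M] by (auto simp: subalgebra_def past_def space_measure_of_conv)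
qed

text \<open>The shift is invertible, so images can be treated as preimages, for which measurability
  and invariance are formulated.\<close>

lemma shift_vimage: "shift m ` A = shift (- m) -` A"
  by (auto simp: shift_def image_iff) (rule bexI, auto)

lemma shift_image_future:
  fixes A :: "(int \<Rightarrow> 'a) set"
  assumes "A \<in> sets (future m)"
  shows "shift m ` A \<in> sets (future 0)"
proof -
  have "shift (- m) -` cylinder m es = cylinder 0 es" for es :: "'a list"
    by (auto simp: shift_def cylinder_def)
  then have "shift (- m) \<in> future 0 \<rightarrow>\<^sub>M (future m :: (int \<Rightarrow> 'a) measure)"
    unfolding future_def[of m]
    by (intro measurable_measure_of) (auto simp: cylinder_in_future)
  from measurable_sets[OF this assms] show ?thesis by (simp add: shift_vimage)
qed

lemma shift_vimage_in_code_borel: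
  fixes A :: "(int \<Rightarrow> 'a) set"
  assumes "A \<in> sets code_borel" shows "shift 1 -` A \<in> sets code_borel"
proof -
  have "shift 1 \<in> code_borel \<rightarrow>\<^sub>M (code_borel :: (int \<Rightarrow> 'a) measure)"
    unfolding code_borel_def
  proof (rule measurable_sigma_sets[OF sets_measure_of])
    fix U :: "(int \<Rightarrow> 'a) set" assume U: "U \<in> {U. openin (product_topology (\<lambda>_. discrete_topology UNIV) UNIV) U}"
    let ?T = "product_topology (\<lambda>_::int. discrete_topology (UNIV::'a set)) UNIV"
    have "continuous_map ?T ?T (shift 1)"
      unfolding continuous_map_componentwise_UNIV shift_def
      by (auto intro: continuous_map_product_projection)
    from openin_continuous_map_preimage[OF this] U
    show "shift 1 -` U \<inter> space (sigma UNIV {U. openin ?T U}) \<in> sets (sigma UNIV {U. openin ?T U})"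
      by (auto simp: vimage_def)
  qed auto
  from measurable_sets[OF this assms] show ?thesis by simp
qed

text \<open>For \<open>m \<le> 0\<close> the image under \<open>shift m\<close> is a preimage under
  an iterate of the left shift, so invariance under \<open>shift 1\<close> can be iterated.\<close>

lemma shift_invariant_measure:
  assumes "sets M = sets code_borel" "shift_invariant M" "A \<in> sets code_borel" "m \<le> 0"
  shows "emeasure M (shift m ` A) = emeasure M A"
proof -
  have "emeasure M (shift (int n) -` A) = emeasure M A" if "A \<in> sets code_borel" for n A
    using that
  proof (induction n arbitrary: A)
    case 0
    then show ?case by (simp add: shift_def)
  next
    case (Suc n)
    have "shift (int (Suc n)) -` A = shift (int n) -` (shift 1 -` A)"
      by (auto simp: shift_def algebra_simps)
    then show ?case
      using Suc assms shift_vimage_in_code_borel[OF Suc.prems] by (simp add: shift_invariant_def)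
  qed
  from this[OF assms(3), of "nat (- m)"] assms(4) show ?thesis by (simp add: shift_vimage)
qed

context markov_system begin

text \<open>The starting point is allowed to be a function \<open>f\<close> of the code, so that the
  induction can absorb the innermost map, whose choice depends on the code, into
  \<open>f\<close>.\<close>

lemma back_comp_measurable:
  assumes [measurable]: "f \<in> code_borel \<rightarrow>\<^sub>M (borel :: 'a measure)"
  shows "(\<lambda>\<sigma>. back_comp w \<sigma> n (f \<sigma>)) \<in> code_borel \<rightarrow>\<^sub>M borel"
  using assms
proof (induction n arbitrary: f)
  have step: "(\<lambda>\<sigma>. w (\<sigma> i) (f \<sigma>)) \<in> code_borel \<rightarrow>\<^sub>M borel"
    if [measurable]: "f \<in> code_borel \<rightarrow>\<^sub>M (borel :: 'a measure)" for i f
    by (rule measurable_compose_countable'[where g="\<lambda>\<sigma>. \<sigma> i" and I=UNIV]) (auto simp: countable_finite)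
  {
    case 0
    then show ?case using step by simp
  next
    case (Suc n)
    show ?case using Suc.IH[OF step[OF Suc.prems]] by simp
  }
qed

lemma coding_seq_measurable: "(\<lambda>\<sigma>. coding_seq ini w xs \<sigma> n) \<in> code_borel \<rightarrow>\<^sub>M borel"
  unfolding coding_seq_def
  by (intro back_comp_measurable measurable_compose[OF code_coordinate_measurable]) simp

text \<open>Off the domain the approximants are frozen at the default value; the coding map is then
  a pointwise limit of measurable maps everywhere.\<close>

lemma coding_map_measurable:
  assumes "coding_dom ini ter w xs \<in> sets code_borel"
  shows "coding_map ini ter w xs \<in> code_borel \<rightarrow>\<^sub>M borel"
proof (rule borel_measurable_LIMSEQ_metric)
  let ?g = "\<lambda>n \<sigma>. if \<sigma> \<in> coding_dom ini ter w xs then coding_seq ini w xs \<sigma> n else xs (ter (\<sigma> 0))"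
  show "?g n \<in> code_borel \<rightarrow>\<^sub>M borel" for n
    using assms
    by (intro measurable_If_set coding_seq_measurable measurable_compose[OF code_coordinate_measurable]) auto
  show "(\<lambda>n. ?g n \<sigma>) \<longlonglongrightarrow> coding_map ini ter w xs \<sigma>" for \<sigma>
    by (auto simp: coding_map_def coding_dom_def convergent_LIMSEQ_iff)
qed

lemma sum_p_ini: "j \<in> {1..N} \<Longrightarrow> (\<Sum>e | ini e = j. p e x) = indicator (K j) x"
  using p_sum[of j x] p_outside by (cases "x \<in> K j") (auto intro!: sum.neutral)

text \<open>The index set is described through the coding map, whereas the estimates use
  \<open>\<mu>\<close>. Both \<open>p e\<close> integrated against \<open>\<mu>\<close> and its
  composition with the coding map integrated against \<open>M\<close> equal the
  \<open>M\<close>-mass of \<open>cylinder 1 [e]\<close>; summed over the edges leaving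
  \<open>j\<close>, \<open>p e\<close> becomes the indicator of \<open>K j\<close>.\<close>

lemma invariant_cell_measure:
  assumes inv: "invariant_measure K ini w p \<mu>" and cm: "code_measure w p \<mu> M"
    and E: "M \<in> E_class ini ter w p xs" and j: "j \<in> {1..N}"
  shows "measure M (coding_map ini ter w xs -` K j) = measure \<mu> (K j)"
proof -
  let ?F = "coding_map ini ter w xs"
  have sets: "sets M = sets code_borel" and "prob_space M" using cm by (auto simp: code_measure_def)
  interpret M: prob_space M by fact
  have "prob_space \<mu>" and sets_mu: "sets \<mu> = sets borel" using inv by (auto simp: invariant_measure_def)
  interpret \<mu>: prob_space \<mu> by fact
  interpret finite_measure_subalgebra M past
    by unfold_locales (rule subalgebra_past[OF sets])
  have "emeasure M (coding_dom ini ter w xs) = 1" using E by (simp add: E_class_def)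
  \<comment> \<open>A set outside the sigma-algebra would be assigned the value 0, so the value 1
    forces measurability.\<close>
  then have "coding_dom ini ter w xs \<in> sets M" by (metis emeasure_notin_sets zero_neq_one)
  then have F: "?F \<in> M \<rightarrow>\<^sub>M borel"
    using coding_map_measurable sets by (simp cong: measurable_cong_sets)
  have pF: "(\<lambda>\<sigma>. p e (?F \<sigma>)) \<in> borel_measurable M" for e
    by (rule measurable_compose[OF F p_measurable])
  have p\<mu>: "integrable \<mu> (p e)" for e
    by (rule \<mu>.integrable_const_bound[of _ 1]) (use sets_mu p_measurable in \<open>auto simp: p_le_1 cong: measurable_cong_sets\<close>)
  have ipF: "integrable M (\<lambda>\<sigma>. p e (?F \<sigma>))" for e
    by (rule M.integrable_const_bound[of _ 1]) (auto simp: p_le_1 pF)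
  have eq: "(LINT \<sigma>|M. p e (?F \<sigma>)) = (LINT x|\<mu>. p e x)" for e
  proof -
    have cyl: "cylinder 1 [e] \<in> sets M" using sets cylinder_in_code_borel by simp
    have int: "integrable M (indicator (cylinder 1 [e]) :: _ \<Rightarrow> real)"
      using cyl by (intro integrable_real_indicator) (auto simp: M.emeasure_finite less_top[symmetric])
    have "AE \<sigma> in M. real_cond_exp M past (indicator (cylinder 1 [e])) \<sigma> = p e (?F \<sigma>)"
      using E by (simp add: E_class_def)
    then have "(LINT \<sigma>|M. p e (?F \<sigma>)) = (LINT \<sigma>|M. real_cond_exp M past (indicator (cylinder 1 [e])) \<sigma>)"
      by (intro integral_cong_AE pF borel_measurable_cond_exp2) auto
    also have "\<dots> = (LINT \<sigma>|M. indicator (cylinder 1 [e]) \<sigma>)"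
      using real_cond_exp_int(2)[OF int] .
    also have "\<dots> = measure M (cylinder 1 [e])" using cyl by simp
    also have "\<dots> = (LINT x|\<mu>. p e x)"
      using cm by (simp add: code_measure_def measure_path_measure_cylinder)
    finally show ?thesis .
  qed
  have "measure M (?F -` K j) = (LINT \<sigma>|M. indicator (?F -` K j) \<sigma>)"
    using measurable_sets[OF F cell_borel[OF j]] sets_eq_imp_space_eq[OF sets] by simp
  also have "\<dots> = (LINT \<sigma>|M. (\<Sum>e | ini e = j. p e (?F \<sigma>)))"
    by (simp add: sum_p_ini[OF j] indicator_vimage[symmetric])
  also have "\<dots> = (LINT x|\<mu>. (\<Sum>e | ini e = j. p e x))"
    by (simp add: ipF p\<mu> eq)
  also have "\<dots> = measure \<mu> (K j)"
    using cell_borel[OF j] sets_mu by (simp add: sum_p_ini[OF j])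
  finally show ?thesis .
qed

end

section \<open>Comparison of path probabilities\<close>

lemma sum_lists_Suc:
  fixes f :: "'e::finite list \<Rightarrow> 'b::comm_monoid_add"
  shows "(\<Sum>es | length es = Suc n. f es) = (\<Sum>e\<in>UNIV. \<Sum>es | length es = n. f (e # es))"
proof -
  have "(\<Sum>e\<in>UNIV. \<Sum>es | length es = n. f (e # es)) =
      (\<Sum>x\<in>UNIV \<times> {es. length es = n}. f (case x of (e, es) \<Rightarrow> e # es))"
    by (subst sum.cartesian_product) (simp add: split_def)
  also have "\<dots> = (\<Sum>es | length es = Suc n. f es)"
    by (rule sum.reindex_bij_betw)
       (auto simp: bij_betw_def inj_on_def image_iff length_Suc_conv)
  finally show ?thesis by simp
qed

lemma finite_lists_of_length [simp]: "finite {es :: 'e::finite list. length es = n}"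
  using finite_lists_length_eq[of "UNIV :: 'e set" n] by simp

text \<open>The price of replacing one transition probability \<open>u\<close> by \<open>v\<close>:
  for \<open>u > v\<close>, the ratio \<open>u / v\<close> is at most
  \<open>1 + (u - v) / \<delta>\<close>, hence at most the exponential of
  \<open>(u - v) / \<delta>\<close>.\<close>

lemma mult_exp_le:
  fixes u v \<delta> :: real
  assumes "0 < \<delta>" "\<delta> \<le> v"
  shows "u * exp (- (\<bar>u - v\<bar> / \<delta>)) \<le> v"
proof (cases "u \<le> v")
  case True
  have "exp (- (\<bar>u - v\<bar> / \<delta>)) \<le> 1" using assms by simp
  then have "u * exp (- (\<bar>u - v\<bar> / \<delta>)) \<le> max 0 u * 1"
    by (intro mult_mono) auto
  then show ?thesis using True assms by (auto simp: max_def split: if_splits)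
next
  case False
  have "u / v = 1 + (u - v) / v" using assms by (simp add: field_simps)
  also have "\<dots> \<le> 1 + (u - v) / \<delta>"
    using assms False by (simp add: divide_left_mono)
  also have "\<dots> \<le> exp (\<bar>u - v\<bar> / \<delta>)"
    using False exp_ge_add_one_self[of "(u - v) / \<delta>"] by simp
  finally show ?thesis using assms by (simp add: exp_minus field_simps)
qed

text \<open>Up to the crossover index \<open>s = ln b / ln r\<close> the minimum is \<open>b\<close>, from there on it decays
  geometrically; Bernoulli's inequality absorbs the rounding of \<open>s\<close> to an integer.\<close>

lemma sum_min_power_le:
  fixes b r :: real
  assumes b: "0 < b" "b \<le> 1" and r: "0 < r" "r < 1"
  shows "(\<Sum>k<n. min b (r ^ k)) \<le> b * (ln b / ln r + 1 / (1 - r))"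
proof -
  define s where "s = ln b / ln r"
  have s: "0 \<le> s" using b r by (auto simp: s_def divide_nonpos_neg)
  have rs: "r powr s = b" using b r by (simp add: s_def powr_def)
  define l where "l = nat \<lceil>s\<rceil>"
  define u where "u = real l - s"
  have u: "0 \<le> u" "u \<le> 1" using s by (auto simp: u_def l_def) linarith+
  have "(\<Sum>k<n. min b (r ^ k)) \<le> (\<Sum>k<l + n. min b (r ^ k))"
    using b r by (intro sum_mono2) auto
  also have "\<dots> = (\<Sum>k<l. min b (r ^ k)) + (\<Sum>k<n. min b (r ^ (k + l)))"
    using sum.atLeastLessThan_concat[of 0 l "l + n" "\<lambda>k. min b (r ^ k)"]
      sum.shift_bounds_nat_ivl[of "\<lambda>k. min b (r ^ k)" 0 l n]
    by (simp add: lessThan_atLeast0 add.commute)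
  also have "\<dots> \<le> (\<Sum>k<l. b) + (\<Sum>k<n. r ^ l * r ^ k)"
    by (intro add_mono sum_mono) (auto simp: power_add mult.commute)
  also have "(\<Sum>k<n. r ^ l * r ^ k) = r ^ l * (\<Sum>k<n. r ^ k)"
    by (simp add: sum_distrib_left)
  also have "\<dots> \<le> r ^ l * (1 / (1 - r))"
    using r by (intro mult_left_mono) (auto simp: sum_gp_strict divide_right_mono)
  also have "r ^ l = b * r powr u"
    using r b rs by (simp add: u_def powr_diff powr_realpow)
  also have "(\<Sum>k<l. b) + b * r powr u * (1 / (1 - r)) = b * (s + (u + r powr u * (1 / (1 - r))))"
    by (simp add: u_def algebra_simps)
  also have "\<dots> \<le> b * (s + 1 / (1 - r))"
  proof -
    have "r powr u * 1 powr (1 - u) \<le> u * r + (1 - u) * 1"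
      using u r by (intro Youngs_inequality_0) auto
    then have "u * (1 - r) + r powr u \<le> 1" by (simp add: algebra_simps)
    then have "(u * (1 - r) + r powr u) / (1 - r) \<le> 1 / (1 - r)"
      using r by (intro divide_right_mono) auto
    then have "u + r powr u * (1 / (1 - r)) \<le> 1 / (1 - r)"
      using r by (simp add: add_divide_distrib)
    then show ?thesis using b by simp
  qed
  finally show ?thesis by (simp add: s_def)
qed

context markov_system begin

lemma sum_path_prob_Suc:
  "(\<Sum>es | length es = Suc n. path_prob w p x es * g es) =
    (\<Sum>e\<in>UNIV. p e x * (\<Sum>es | length es = n. path_prob w p (w e x) es * g (e # es)))"
  by (simp add: sum_lists_Suc sum_distrib_left mult.assoc)

lemma sum_path_prob: "(\<Sum>es | length es = n. path_prob w p x es) = 1"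
proof (induction n arbitrary: x)
  case (Suc n)
  then show ?case using sum_path_prob_Suc[of x "\<lambda>_. 1"] by (simp add: p_sum_UNIV)
qed simp

text \<open>Marginalisation: the letters after the first \<open>k\<close> sum out to 1.\<close>

lemma sum_path_prob_take:
  "k \<le> n \<Longrightarrow> (\<Sum>es | length es = n. path_prob w p x es * g (take k es)) =
    (\<Sum>es | length es = k. path_prob w p x es * g es)"
proof (induction n arbitrary: k x g)
  case (Suc n)
  show ?case
  proof (cases k)
    case 0
    then show ?thesis by (simp add: sum_path_prob flip: sum_distrib_right)
  next
    case (Suc k')
    then show ?thesis
      using Suc.IH[of k' _ "\<lambda>es. g (_ # es)"] Suc.prems by (simp add: sum_path_prob_Suc)
  qed
qed simp

definition osc :: "'a \<Rightarrow> 'a \<Rightarrow> 'e list \<Rightarrow> nat \<Rightarrow> real" where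
  "osc x y es k = \<bar>p (es ! k) (fold w (take k es) x) - p (es ! k) (fold w (take k es) y)\<bar>"

text \<open>The one-step price \<open>mult_exp_le\<close> is multiplied along the word. An edge that
  does not leave the common cell makes the left side 0; any other edge carries both orbits into one
  cell again.\<close>

lemma path_prob_compare:
  assumes "0 < \<delta>" and lb: "\<And>e x. x \<in> K (ini e) \<Longrightarrow> \<delta> \<le> p e x"
    and "j \<in> {1..N}" "x \<in> K j" "y \<in> K j"
  shows "path_prob w p x es * exp (- ((\<Sum>k<length es. osc x y es k) / \<delta>)) \<le> path_prob w p y es"
  using assms(3-5)
proof (induction es arbitrary: x y j)
  case (Cons e es)
  show ?case
  proof (cases "ini e = j")
    case False
    then have "p e x = 0" using Cons.prems cell_unique[OF _ _ ini_vertex] by (intro p_outside) blast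
    then show ?thesis by (simp add: path_prob_nonneg)
  next
    case True
    have wk: "w e x \<in> K (ter e)" "w e y \<in> K (ter e)" using w_cell True Cons.prems by blast+
    have osc: "(\<Sum>k<length (e # es). osc x y (e # es) k) =
        \<bar>p e x - p e y\<bar> + (\<Sum>k<length es. osc (w e x) (w e y) es k)"
      by (simp only: length_Cons sum.lessThan_Suc_shift) (simp add: osc_def)
    have "path_prob w p x (e # es) * exp (- ((\<Sum>k<length (e # es). osc x y (e # es) k) / \<delta>)) =
      (p e x * exp (- (\<bar>p e x - p e y\<bar> / \<delta>))) *
      (path_prob w p (w e x) es * exp (- ((\<Sum>k<length es. osc (w e x) (w e y) es k) / \<delta>)))"
      unfolding osc by (simp add: add_divide_distrib exp_add[symmetric] minus_add_distrib[symmetric] del: minus_add_distrib)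
    also have "\<dots> \<le> p e y * path_prob w p (w e y) es"
      using True Cons.prems lb assms(1)
      by (intro mult_mono mult_exp_le Cons.IH[OF ter_vertex wk]) (auto simp: path_prob_nonneg)
    finally show ?thesis by simp
  qed
qed simp

lemma path_prob_take_nonzero: "path_prob w p x es \<noteq> 0 \<Longrightarrow> path_prob w p x (take k es) \<noteq> 0"
  by (induction es arbitrary: x k) (auto simp: take_Cons split: nat.splits)

lemma fold_same_cell:
  assumes "path_prob w p x es \<noteq> 0" "j \<in> {1..N}" "x \<in> K j" "y \<in> K j"
  shows "\<exists>j\<in>{1..N}. fold w es x \<in> K j \<and> fold w es y \<in> K j"
  using assms
proof (induction es arbitrary: x y j)
  case (Cons e es)
  then have "p e x \<noteq> 0" by auto
  then have "x \<in> K (ini e)" using p_outside by blast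
  then have "ini e = j" using Cons.prems cell_unique[OF _ _ ini_vertex] by blast
  then have "w e x \<in> K (ter e)" "w e y \<in> K (ter e)" using w_cell Cons.prems by blast+
  then show ?case using Cons.IH[OF _ ter_vertex] Cons.prems by simp
qed auto

text \<open>Within distance \<open>t\<close> the modulus \<open>Delta\<close> applies; beyond it the
  trivial bound 1 is used, so that only the probability of being far apart has to be
  controlled.\<close>

lemma osc_le:
  assumes nz: "path_prob w p x es \<noteq> 0" and j: "j \<in> {1..N}" "x \<in> K j" "y \<in> K j" and "0 \<le> t"
  shows "osc x y es k \<le> Delta K ini p t +
    of_bool (t < dist (fold w (take k es) x) (fold w (take k es) y))"
proof -
  let ?x = "fold w (take k es) x" and ?y = "fold w (take k es) y" and ?e = "es ! k"
  have \<Delta>: "0 \<le> Delta K ini p t" using \<open>0 \<le> t\<close> by (rule Delta_nonneg)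
  obtain i where i: "i \<in> {1..N}" "?x \<in> K i" "?y \<in> K i"
    using fold_same_cell[OF path_prob_take_nonzero[OF nz] j] by blast
  show ?thesis
  proof (cases "ini ?e = i")
    case True
    then show ?thesis
      using Delta_upper[of ?x ?e ?y t] osc_le_1[of ?e ?x ?y] i \<Delta> by (auto simp: osc_def)
  next
    case False
    \<comment> \<open>An edge that does not leave the common cell has probability 0 at both
      points.\<close>
    then have "p ?e ?x = 0" "p ?e ?y = 0"
      using i cell_unique[OF _ _ ini_vertex] by (blast intro: p_outside)+
    then show ?thesis using \<Delta> by (simp add: osc_def)
  qed
qed

text \<open>Contractivity is averaged with the weights of the orbit of \<open>x\<close> only.
  Conditioning on the first edge iterates it, because each edge of positive probability keeps the
  two points in a common cell.\<close>

lemma contract_iterate: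
  assumes contr: "contractive N K ini w p a" and "j \<in> {1..N}" "x \<in> K j" "y \<in> K j"
  shows "(\<Sum>es | length es = k. path_prob w p x es * dist (fold w es x) (fold w es y)) \<le> a ^ k * dist x y"
  using assms(2-4)
proof (induction k arbitrary: x y j)
  case (Suc k)
  have a: "0 < a" using contr by (simp add: contractive_def)
  have "(\<Sum>es | length es = Suc k. path_prob w p x es * dist (fold w es x) (fold w es y)) =
    (\<Sum>e\<in>UNIV. p e x * (\<Sum>es | length es = k. path_prob w p (w e x) es * dist (fold w es (w e x)) (fold w es (w e y))))"
    by (simp add: sum_path_prob_Suc)
  also have "\<dots> \<le> (\<Sum>e\<in>UNIV. p e x * (a ^ k * dist (w e x) (w e y)))"
  proof (intro sum_mono)
    fix e
    show "p e x * (\<Sum>es | length es = k. path_prob w p (w e x) es * dist (fold w es (w e x)) (fold w es (w e y)))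
      \<le> p e x * (a ^ k * dist (w e x) (w e y))"
    proof (cases "ini e = j")
      case True
      then have "w e x \<in> K (ter e)" "w e y \<in> K (ter e)" using w_cell Suc.prems by blast+
      then show ?thesis using Suc.IH[OF ter_vertex] by (intro mult_left_mono) auto
    next
      case False
      then have "p e x = 0" using Suc.prems cell_unique[OF _ _ ini_vertex] by (intro p_outside) blast
      then show ?thesis by simp
    qed
  qed
  also have "\<dots> = a ^ k * (\<Sum>e\<in>UNIV. p e x * dist (w e x) (w e y))"
    by (simp add: sum_distrib_left mult_ac)
  also have "(\<Sum>e\<in>UNIV. p e x * dist (w e x) (w e y)) = (\<Sum>e | ini e = j. p e x * dist (w e x) (w e y))"
    using Suc.prems by (simp add: sum_ini)
  also have "a ^ k * \<dots> \<le> a ^ k * (a * dist x y)"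
    using contr Suc.prems a by (intro mult_left_mono) (auto simp: contractive_def)
  finally show ?case by (simp add: mult_ac)
qed simp

end

section \<open>The invariant measure\<close>

locale coded_markov_system = markov_system N K ini ter w p
  for N :: nat and K :: "nat \<Rightarrow> 'a::polish_space set" and ini ter :: "'e::finite \<Rightarrow> nat"
    and w :: "'e \<Rightarrow> 'a \<Rightarrow> 'a" and p :: "'e \<Rightarrow> 'a \<Rightarrow> real" +
  fixes \<mu> :: "'a measure" and xs :: "nat \<Rightarrow> 'a" and a :: real
  assumes invariant: "invariant_measure K ini w p \<mu>"
    and base_points: "\<And>i. i \<in> {1..N} \<Longrightarrow> xs i \<in> K i"
    and contractive: "contractive N K ini w p a"
begin

text \<open>The partner with which \<open>x\<close> is compared; \<open>THE\<close> is well defined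
  because the cells partition the space.\<close>

definition base :: "'a \<Rightarrow> 'a" where
  "base x = xs (THE j. j \<in> {1..N} \<and> x \<in> K j)"

lemma base_eq: "j \<in> {1..N} \<Longrightarrow> x \<in> K j \<Longrightarrow> base x = xs j"
  unfolding base_def by (rule arg_cong[where f=xs], rule the_equality) (auto intro: cell_unique)

lemma base_cell: "\<exists>j\<in>{1..N}. x \<in> K j \<and> base x \<in> K j"
  using cell_ex[of x] base_eq base_points by metis

lemma sets_\<mu> [measurable_cong]: "sets \<mu> = sets borel"
  using invariant by (simp add: invariant_measure_def)

lemma space_\<mu> [simp]: "space \<mu> = UNIV"
  using sets_eq_imp_space_eq[OF sets_\<mu>] by simp

sublocale \<mu>: prob_space \<mu>
  using invariant by (simp add: invariant_measure_def)

lemma base_measurable [measurable]: "base \<in> borel \<rightarrow>\<^sub>M borel"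
proof (rule measurableI)
  fix B :: "'a set" assume "B \<in> sets borel"
  have "base -` B = (\<Union>j\<in>{j\<in>{1..N}. xs j \<in> B}. K j)"
    using cell_ex base_eq by (fastforce simp: vimage_def)
  also have "\<dots> \<in> sets borel" by (intro sets.finite_UN cell_borel) auto
  finally show "base -` B \<inter> space borel \<in> sets borel" by simp
qed simp

lemma fold_w_measurable [measurable]: "fold w es \<in> borel \<rightarrow>\<^sub>M borel"
  by (induction es) (auto simp: id_def intro!: measurable_comp[where N=borel])

text \<open>Invariance is stated for sets; indicators, multiples, sums and increasing limits extend
  it to nonnegative functions.\<close>

lemma nn_integral_invariant:
  assumes "g \<in> borel_measurable borel"
  shows "(\<integral>\<^sup>+x. g x \<partial>\<mu>) = (\<integral>\<^sup>+x. (\<Sum>e\<in>UNIV. ennreal (p e x) * g (w e x)) \<partial>\<mu>)"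
proof -
  have "(\<integral>\<^sup>+x. g x \<partial>\<mu>) = (\<Sum>e\<in>UNIV. \<integral>\<^sup>+x. ennreal (p e x) * g (w e x) \<partial>\<mu>)"
    using assms
  proof (induction rule: borel_measurable_induct)
    case (cong f g)
    then show ?case by simp
  next
    case (set B)
    have int: "integrable \<mu> (\<lambda>x. p e x * indicator B (w e x))" for e
      using set by (intro \<mu>.integrable_const_bound[of _ 1]) (auto simp: p_le_1 indicator_def)
    have "(\<integral>\<^sup>+x. indicator B x \<partial>\<mu>) = ennreal (measure \<mu> B)"
      using set by (simp add: \<mu>.emeasure_eq_measure)
    also have "measure \<mu> B = (\<Sum>e\<in>UNIV. LINT x:K (ini e)|\<mu>. p e x * indicator B (w e x))"
      using set invariant by (simp add: invariant_measure_def)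
    also have "\<dots> = (\<Sum>e\<in>UNIV. LINT x|\<mu>. p e x * indicator B (w e x))"
      unfolding set_lebesgue_integral_def
      by (intro sum.cong Bochner_Integration.integral_cong refl) (auto simp: indicator_def p_outside)
    also have "ennreal \<dots> = (\<Sum>e\<in>UNIV. ennreal (LINT x|\<mu>. p e x * indicator B (w e x)))"
      by (intro sum_ennreal[symmetric] integral_nonneg_AE) auto
    also have "\<dots> = (\<Sum>e\<in>UNIV. \<integral>\<^sup>+x. ennreal (p e x * indicator B (w e x)) \<partial>\<mu>)"
      by (intro sum.cong nn_integral_eq_integral[symmetric] int) auto
    finally show ?case by (simp add: ennreal_mult' ennreal_indicator)
  next
    case (mult u c)
    then have "u \<in> borel_measurable borel" by simp
    then show ?case using mult
      by (simp add: nn_integral_cmult sum_distrib_left mult.left_commute[of _ c])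
  next
    case (add u v)
    then show ?case by (simp add: nn_integral_add sum.distrib distrib_left)
  next
    case (seq U)
    have [measurable]: "U i \<in> borel_measurable borel" for i using seq by simp
    have "(\<integral>\<^sup>+x. (SUP i. U i) x \<partial>\<mu>) = (SUP i. \<integral>\<^sup>+x. U i x \<partial>\<mu>)"
      unfolding SUP_apply by (rule nn_integral_monotone_convergence_SUP) (use seq in auto)
    also have "\<dots> = (SUP i. \<Sum>e\<in>UNIV. \<integral>\<^sup>+x. ennreal (p e x) * U i (w e x) \<partial>\<mu>)"
      using seq by simp
    also have "\<dots> = (\<Sum>e\<in>UNIV. SUP i. \<integral>\<^sup>+x. ennreal (p e x) * U i (w e x) \<partial>\<mu>)"
      using seq by (intro ennreal_SUP_sum) (auto simp: incseq_def le_fun_def intro!: nn_integral_mono mult_left_mono)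
    also have "\<dots> = (\<Sum>e\<in>UNIV. \<integral>\<^sup>+x. (SUP i. ennreal (p e x) * U i (w e x)) \<partial>\<mu>)"
      using seq by (intro sum.cong nn_integral_monotone_convergence_SUP[symmetric])
        (auto simp: incseq_def le_fun_def intro!: mult_left_mono)
    finally show ?case by (simp add: SUP_mult_left_ennreal SUP_apply image_comp)
  qed
  also have "\<dots> = (\<integral>\<^sup>+x. (\<Sum>e\<in>UNIV. ennreal (p e x) * g (w e x)) \<partial>\<mu>)"
    using assms by (intro nn_integral_sum[symmetric]) auto
  finally show ?thesis .
qed

text \<open>The truncations of \<open>f x = dist x (base x)\<close> at height \<open>n\<close> are integrable, and invariance
  gives \<open>\<integral> min (f x) n \<le> \<integral> min (a * f x + R) n\<close>; by Fatou's lemma \<open>(1 - a) * \<integral> f \<le> R\<close>.\<close>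

lemma integrable_dist_base: "integrable \<mu> (\<lambda>x. dist x (base x))"
proof -
  define f where "f x = dist x (base x)" for x
  have f [measurable]: "f \<in> borel_measurable borel" unfolding f_def by measurable
  have f0: "0 \<le> f x" for x by (simp add: f_def)
  \<comment> \<open>\<open>R\<close> pays for replacing the image of a base point by the base point
    of the target cell. Together with contractivity this gives the drift inequality.\<close>
  define R where "R = (\<Sum>e\<in>UNIV. dist (w e (xs (ini e))) (xs (ter e)))"
  have R: "0 \<le> R" by (simp add: R_def sum_nonneg)
  have a: "0 < a" "a < 1" using contractive by (auto simp: contractive_def)
  have drift: "(\<Sum>e\<in>UNIV. p e x * f (w e x)) \<le> a * f x + R" for x
  proof -
    obtain j where j: "j \<in> {1..N}" "x \<in> K j" using cell_ex by blast
    have le: "p e x * f (w e x) \<le> p e x * dist (w e x) (w e (base x)) + dist (w e (xs (ini e))) (xs (ter e))" for e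
    proof (cases "x \<in> K (ini e)")
      case True
      then have "base x = xs (ini e)" "base (w e x) = xs (ter e)"
        using base_eq ini_vertex ter_vertex w_cell by blast+
      then have "p e x * f (w e x) \<le> p e x * (dist (w e x) (w e (base x)) + dist (w e (xs (ini e))) (xs (ter e)))"
        unfolding f_def by (intro mult_left_mono) (auto simp: dist_triangle)
      also have "\<dots> \<le> p e x * dist (w e x) (w e (base x)) + 1 * dist (w e (xs (ini e))) (xs (ter e))"
        unfolding distrib_left by (intro add_left_mono mult_right_mono) (auto simp: p_le_1)
      finally show ?thesis by simp
    qed (simp add: p_outside)
    have "(\<Sum>e\<in>UNIV. p e x * f (w e x)) \<le> (\<Sum>e\<in>UNIV. p e x * dist (w e x) (w e (base x))) + R"
      unfolding R_def sum.distrib[symmetric] by (intro sum_mono le)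
    also have "(\<Sum>e\<in>UNIV. p e x * dist (w e x) (w e (base x))) \<le> a * f x"
      using contractive_def[THEN iffD1, OF contractive] j base_eq[OF j] base_points[OF j(1)]
      by (simp add: sum_ini[OF j, symmetric] f_def)
    finally show ?thesis by simp
  qed
  \<comment> \<open>Adding \<open>R\<close> makes the truncated difference nonnegative, as Fatou's
    lemma requires, while its integral stays below \<open>R\<close>.\<close>
  define \<psi> where "\<psi> n x = min (f x) (real n) - min (a * f x + R) (real n) + R" for n x
  have [measurable]: "\<psi> n \<in> borel_measurable borel" for n unfolding \<psi>_def by measurable
  have af: "a * f x \<le> f x" for x using a f0[of x] by (simp add: mult_left_le_one_le)
  have \<psi>0: "0 \<le> \<psi> n x" for n x using af[of x] R f0[of x] by (auto simp: \<psi>_def min_def)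
  have int1: "integrable \<mu> (\<lambda>x. min (f x) (real n))" for n
    using f0 by (intro \<mu>.integrable_const_bound[of _ "real n"]) auto
  have int2: "integrable \<mu> (\<lambda>x. min (a * f x + R) (real n))" for n
    using f0 R a by (intro \<mu>.integrable_const_bound[of _ "real n"]) auto
  have le: "(LINT x|\<mu>. min (f x) (real n)) \<le> (LINT x|\<mu>. min (a * f x + R) (real n))" for n
  proof -
    have "ennreal (LINT x|\<mu>. min (f x) (real n)) = (\<integral>\<^sup>+x. ennreal (min (f x) (real n)) \<partial>\<mu>)"
      using f0 by (intro nn_integral_eq_integral[symmetric] int1) auto
    also have "\<dots> = (\<integral>\<^sup>+x. (\<Sum>e\<in>UNIV. ennreal (p e x) * ennreal (min (f (w e x)) (real n))) \<partial>\<mu>)"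
      by (rule nn_integral_invariant) measurable
    also have "\<dots> \<le> (\<integral>\<^sup>+x. ennreal (min (a * f x + R) (real n)) \<partial>\<mu>)"
    proof (intro nn_integral_mono)
      fix x
      have "(\<Sum>e\<in>UNIV. ennreal (p e x) * ennreal (min (f (w e x)) (real n))) =
          ennreal (\<Sum>e\<in>UNIV. p e x * min (f (w e x)) (real n))"
        using f0 by (simp add: ennreal_mult[symmetric])
      also have "\<dots> \<le> ennreal (min (a * f x + R) (real n))"
      proof (intro ennreal_leI min.boundedI)
        have "(\<Sum>e\<in>UNIV. p e x * min (f (w e x)) (real n)) \<le> (\<Sum>e\<in>UNIV. p e x * f (w e x))"
          by (intro sum_mono mult_left_mono) auto
        then show "(\<Sum>e\<in>UNIV. p e x * min (f (w e x)) (real n)) \<le> a * f x + R"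
          using drift[of x] by simp
        have "(\<Sum>e\<in>UNIV. p e x * min (f (w e x)) (real n)) \<le> (\<Sum>e\<in>UNIV. p e x * real n)"
          by (intro sum_mono mult_left_mono) auto
        then show "(\<Sum>e\<in>UNIV. p e x * min (f (w e x)) (real n)) \<le> real n"
          by (simp add: p_sum_UNIV flip: sum_distrib_right)
      qed
      finally show "(\<Sum>e\<in>UNIV. ennreal (p e x) * ennreal (min (f (w e x)) (real n)))
        \<le> ennreal (min (a * f x + R) (real n))" .
    qed
    also have "\<dots> = ennreal (LINT x|\<mu>. min (a * f x + R) (real n))"
      using f0 R a by (intro nn_integral_eq_integral int2) auto
    finally show ?thesis
      using f0 R a by (subst (asm) ennreal_le_iff) (auto intro!: integral_nonneg_AE)
  qed
  have \<psi>_le: "(\<integral>\<^sup>+x. ennreal (\<psi> n x) \<partial>\<mu>) \<le> ennreal R" for n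
  proof -
    have "(\<integral>\<^sup>+x. ennreal (\<psi> n x) \<partial>\<mu>) = ennreal (LINT x|\<mu>. \<psi> n x)"
      using int1 int2 \<psi>0 by (intro nn_integral_eq_integral) (auto simp: \<psi>_def)
    also have "(LINT x|\<mu>. \<psi> n x) \<le> R"
      using int1[of n] int2[of n] le[of n] by (simp add: \<psi>_def \<mu>.prob_space[simplified])
    finally show ?thesis by (simp add: ennreal_leI)
  qed
  have "ennreal ((1 - a) * f x) \<le> liminf (\<lambda>n. ennreal (\<psi> n x))" for x
  proof (intro Liminf_bounded)
    obtain m where m: "f x + R \<le> real m" using real_arch_simple by blast
    \<comment> \<open>Once \<open>n\<close> exceeds \<open>f x + R\<close>, neither truncation is
      active and the two occurrences of \<open>R\<close> cancel.\<close>
    have "\<psi> n x = (1 - a) * f x" if "n \<ge> m" for n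
    proof -
      have "real m \<le> real n" using that by simp
      then show ?thesis using m R af[of x] f0[of x] by (simp add: \<psi>_def min_absorb1 algebra_simps)
    qed
    then show "eventually (\<lambda>n. ennreal ((1 - a) * f x) \<le> ennreal (\<psi> n x)) sequentially"
      unfolding eventually_sequentially by (intro exI[of _ m]) auto
  qed
  then have "(\<integral>\<^sup>+x. ennreal ((1 - a) * f x) \<partial>\<mu>) \<le> (\<integral>\<^sup>+x. liminf (\<lambda>n. ennreal (\<psi> n x)) \<partial>\<mu>)"
    by (intro nn_integral_mono)
  also have "\<dots> \<le> liminf (\<lambda>n. \<integral>\<^sup>+x. ennreal (\<psi> n x) \<partial>\<mu>)"
    by (rule nn_integral_liminf) measurable
  also have "\<dots> \<le> liminf (\<lambda>n. ennreal R)"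
    by (intro Liminf_mono always_eventually allI \<psi>_le)
  also have "\<dots> < \<infinity>" by (simp add: Liminf_const)
  finally have "integrable \<mu> (\<lambda>x. (1 - a) * f x)"
    using f0 a by (intro integrableI_nonneg) auto
  then show ?thesis using a by (simp add: f_def)
qed

lemma mean_dist_eq: "mean_dist N K xs \<mu> = (LINT x|\<mu>. dist x (base x))"
proof -
  have int: "integrable \<mu> (\<lambda>x. indicator (K j) x * dist x (base x))" if "j \<in> {1..N}" for j
    using integrable_real_mult_indicator[of "K j" \<mu>, OF _ integrable_dist_base] cell_borel[OF that]
    by (simp add: sets_\<mu> mult.commute)
  have "mean_dist N K xs \<mu> = (\<Sum>j\<in>{1..N}. LINT x|\<mu>. indicator (K j) x * dist x (base x))"
    unfolding mean_dist_def set_lebesgue_integral_def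
    by (intro sum.cong Bochner_Integration.integral_cong refl) (auto simp: indicator_def base_eq)
  also have "\<dots> = (LINT x|\<mu>. (\<Sum>j\<in>{1..N}. indicator (K j) x * dist x (base x)))"
    using int by (intro Bochner_Integration.integral_sum[symmetric])
  also have "\<dots> = (LINT x|\<mu>. dist x (base x))"
  proof (intro Bochner_Integration.integral_cong refl)
    fix x
    obtain j where "j \<in> {1..N}" "x \<in> K j" using cell_ex by blast
    then have "(\<Sum>i\<in>{1..N}. indicator (K i) x :: real) = (\<Sum>i\<in>{j}. indicator (K i) x)"
      using cell_unique by (intro sum.mono_neutral_right) (auto simp: indicator_def)
    then show "(\<Sum>j\<in>{1..N}. indicator (K j) x * dist x (base x)) = dist x (base x)"
      using \<open>x \<in> K j\<close> by (simp flip: sum_distrib_right)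
  qed
  finally show ?thesis .
qed

text \<open>Under \<open>\<mu>\<close> the base point is \<open>xs j\<close> with weight
  \<open>measure \<mu> (K j)\<close>, which is at most 1 and vanishes for \<open>j\<close> outside
  \<open>V\<close>.\<close>

lemma integral_base:
  fixes h :: "'a \<Rightarrow> real"
  assumes nonneg: "\<And>x. 0 \<le> h x" and V: "finite V"
    and pos: "\<And>j. j \<in> {1..N} \<Longrightarrow> measure \<mu> (K j) > 0 \<Longrightarrow> j \<in> V"
  shows "(LINT x|\<mu>. h (base x)) \<le> (\<Sum>j\<in>V. h (xs j))"
proof -
  have K: "K j \<in> sets \<mu>" if "j \<in> {1..N}" for j using cell_borel that by (simp add: sets_\<mu>)
  have "(LINT x|\<mu>. h (base x)) = (LINT x|\<mu>. (\<Sum>j\<in>{1..N}. indicator (K j) x * h (xs j)))"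
  proof (intro Bochner_Integration.integral_cong refl)
    fix x
    obtain j where j: "j \<in> {1..N}" "x \<in> K j" using cell_ex by blast
    then have "(\<Sum>i\<in>{1..N}. indicator (K i) x * h (xs i)) = (\<Sum>i\<in>{j}. indicator (K i) x * h (xs i))"
      using cell_unique by (intro sum.mono_neutral_right) (auto simp: indicator_def)
    then show "h (base x) = (\<Sum>j\<in>{1..N}. indicator (K j) x * h (xs j))"
      using j by (simp add: base_eq)
  qed
  also have "\<dots> = (\<Sum>j\<in>{1..N}. measure \<mu> (K j) * h (xs j))"
    using K by (subst Bochner_Integration.integral_sum) (auto simp: \<mu>.emeasure_eq_measure)
  also have "\<dots> = (\<Sum>j\<in>{1..N} \<inter> V. measure \<mu> (K j) * h (xs j))"
    using pos by (intro sum.mono_neutral_right) (auto simp: zero_less_measure_iff order_less_le)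
  also have "\<dots> \<le> (\<Sum>j\<in>{1..N} \<inter> V. h (xs j))"
    using nonneg \<mu>.prob_le_1 by (intro sum_mono mult_left_le_one_le) auto
  also have "\<dots> \<le> (\<Sum>j\<in>V. h (xs j))"
    using V nonneg by (intro sum_mono2) auto
  finally show ?thesis .
qed

end

section \<open>The lower bound\<close>

context coded_markov_system begin

lemma integrable_bounded:
  fixes h :: "'a \<Rightarrow> real"
  assumes "h \<in> borel_measurable borel" "\<And>x. \<bar>h x\<bar> \<le> B"
  shows "integrable \<mu> h"
  by (rule \<mu>.integrable_const_bound[of _ B]) (use assms in auto)

text \<open>Markov's inequality: the mean distance after \<open>k\<close> steps is at most
  \<open>a ^ k * C\<close>, and dividing by the threshold leaves
  \<open>(a powr q) ^ k\<close>.\<close>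

lemma far_apart_le:
  defines "C \<equiv> mean_dist N K xs \<mu>"
  shows "(LINT x|\<mu>. (\<Sum>es | length es = k. path_prob w p x es *
      of_bool (a powr ((1 - q) * real k) * C < dist (fold w es x) (fold w es (base x))))) \<le> (a powr q) ^ k"
proof -
  define S where "S x = (\<Sum>es | length es = k. path_prob w p x es *
      of_bool (a powr ((1 - q) * real k) * C < dist (fold w es x) (fold w es (base x))))" for x
  have a: "0 < a" using contractive by (simp add: contractive_def)
  have S0: "0 \<le> S x" for x unfolding S_def by (intro sum_nonneg mult_nonneg_nonneg path_prob_nonneg) auto
  have [measurable]: "S \<in> borel_measurable borel" unfolding S_def by measurable
  have "S x \<le> (\<Sum>es | length es = k. path_prob w p x es)" for x
    unfolding S_def by (intro sum_mono) (auto simp: path_prob_nonneg)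
  then have "S x \<le> 1" for x by (simp add: sum_path_prob)
  then have S_int: "integrable \<mu> S" using S0 by (intro integrable_bounded[of _ 1]) auto
  have C: "C = (LINT x|\<mu>. dist x (base x))" by (simp add: C_def mean_dist_eq)
  then have "0 \<le> C" by (simp add: integral_nonneg_AE)
  have markov: "(a powr ((1 - q) * real k) * C) * S x \<le> a ^ k * dist x (base x)" for x
  proof -
    obtain j where j: "j \<in> {1..N}" "x \<in> K j" "base x \<in> K j" using base_cell by blast
    have "(a powr ((1 - q) * real k) * C) * S x \<le>
        (\<Sum>es | length es = k. path_prob w p x es * dist (fold w es x) (fold w es (base x)))"
      unfolding S_def sum_distrib_left
    proof (intro sum_mono)
      fix es
      show "(a powr ((1 - q) * real k) * C) * (path_prob w p x es *
          of_bool (a powr ((1 - q) * real k) * C < dist (fold w es x) (fold w es (base x))))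
        \<le> path_prob w p x es * dist (fold w es x) (fold w es (base x))"
        using path_prob_nonneg[of x es]
        by (cases "a powr ((1 - q) * real k) * C < dist (fold w es x) (fold w es (base x))")
          (auto simp: mult.commute[of "a powr _ * _"] intro: mult_left_mono)
    qed
    also have "\<dots> \<le> a ^ k * dist x (base x)"
      by (rule contract_iterate[OF contractive j])
    finally show ?thesis .
  qed
  have "(LINT x|\<mu>. S x) \<le> (a powr q) ^ k"
  proof (cases "C = 0")
    case True
    \<comment> \<open>A zero threshold cannot be divided by, but then almost every \<open>x\<close>
      equals its base point and the two orbits coincide.\<close>
    have "AE x in \<mu>. dist x (base x) = 0"
      using integral_nonneg_eq_0_iff_AE[OF integrable_dist_base] C True by simp
    then have "AE x in \<mu>. S x = 0"
      by eventually_elim (simp add: S_def True)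
    then have "(LINT x|\<mu>. S x) = (LINT x|\<mu>. 0)" by (intro integral_cong_AE) auto
    then show ?thesis by simp
  next
    case False
    then have "0 < C" using \<open>0 \<le> C\<close> by simp
    have "(LINT x|\<mu>. (a powr ((1 - q) * real k) * C) * S x) \<le> (LINT x|\<mu>. a ^ k * dist x (base x))"
      by (intro integral_mono markov integrable_mult_right S_int integrable_dist_base)
    then have "(a powr ((1 - q) * real k) * C) * (LINT x|\<mu>. S x) \<le> a ^ k * C"
      by (simp add: C)
    also have "a ^ k = a powr ((1 - q) * real k) * (a powr q) ^ k"
      using a by (simp add: powr_realpow[symmetric] powr_powr powr_add[symmetric] algebra_simps)
    finally show ?thesis using a \<open>0 < C\<close> by simp
  qed
  then show ?thesis by (simp only: S_def)
qed

text \<open>Here \<open>b\<close> is the mass of the words in \<open>L'\<close> under the chain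
  started from \<open>\<mu>\<close>. The exponent bounds the mean over these words of the
  logarithmic price of moving the start to the base point.\<close>

lemma path_set_estimate:
  fixes L :: "'e list set" and n :: nat
  defines "C \<equiv> mean_dist N K xs \<mu>"
  defines "L' \<equiv> {es. es \<in> L \<and> length es = n}"
  defines "b \<equiv> LINT x|\<mu>. (\<Sum>es\<in>L'. path_prob w p x es)"
  assumes \<delta>: "0 < \<delta>" and lb: "\<And>e x. x \<in> K (ini e) \<Longrightarrow> \<delta> \<le> p e x"
    and dini: "\<And>e. dini_continuous_on (K (ini e)) (p e)"
    and q: "0 < q" "q < 1" and b: "0 < b"
  shows "b * exp (- (1 / \<delta>) * ((\<Sum>i. Delta K ini p (a powr ((1 - q) * real i) * C)) +
      (ln b / ln (a powr q) + 1 / (1 - a powr q))))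
    \<le> (LINT x|\<mu>. (\<Sum>es\<in>L'. path_prob w p (base x) es))"
proof -
  have a: "0 < a" "a < 1" using contractive by (auto simp: contractive_def)
  define r where "r = a powr q"
  have r: "0 < r" "r < 1" using a q powr_less_mono'[of a 0 q] by (auto simp: r_def)
  have C0: "0 \<le> C" by (simp add: C_def mean_dist_eq integral_nonneg_AE)
  \<comment> \<open>The threshold decays geometrically, which makes \<open>D\<close> summable, yet
    more slowly than the bound \<open>a ^ k * C\<close> on the mean distance, which makes far-apart
    orbits rare.\<close>
  define t where "t k = a powr ((1 - q) * real k) * C" for k
  have t0: "0 \<le> t k" for k using C0 by (simp add: t_def)
  define D where "D k = Delta K ini p (t k)" for k
  have D0: "0 \<le> D k" for k by (simp add: D_def Delta_nonneg t0)
  have "0 < a powr (1 - q)" "a powr (1 - q) < 1" using a q powr_less_mono'[of a 0 "1 - q"] by auto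
  from Delta_summable[OF dini this C0] have D_sum: "summable D"
    using a by (simp add: D_def[abs_def] t_def powr_realpow[symmetric] powr_powr)
  have len: "length es = n" if "es \<in> L'" for es using that by (simp add: L'_def)
  define S where "S x = (\<Sum>es\<in>L'. path_prob w p x es)" for x
  have [measurable]: "S \<in> borel_measurable borel" unfolding S_def by measurable
  have S0: "0 \<le> S x" for x by (simp add: S_def sum_nonneg path_prob_nonneg)
  have S1: "S x \<le> 1" for x
  proof -
    have "S x \<le> (\<Sum>es | length es = n. path_prob w p x es)"
      unfolding S_def by (intro sum_mono2) (auto simp: L'_def path_prob_nonneg)
    then show ?thesis by (simp add: sum_path_prob)
  qed
  have S_int: "integrable \<mu> S" using S0 S1 by (intro integrable_bounded[of _ 1]) auto
  have bS: "b = (LINT x|\<mu>. S x)" by (simp add: b_def S_def)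
  have b1: "b \<le> 1"
    unfolding bS using S1 by (intro \<mu>.integral_le_const S_int) auto
  define bad where "bad k x es \<longleftrightarrow> t k < dist (fold w (take k es) x) (fold w (take k es) (base x))" for k x es
  define B where "B k x = (\<Sum>es\<in>L'. path_prob w p x es * of_bool (bad k x es))" for k x
  have [measurable]: "B k \<in> borel_measurable borel" for k unfolding B_def bad_def by measurable
  have B0: "0 \<le> B k x" for k x by (simp add: B_def sum_nonneg path_prob_nonneg)
  have BS: "B k x \<le> S x" for k x
    unfolding B_def S_def by (intro sum_mono) (auto simp: path_prob_nonneg)
  have B_int: "integrable \<mu> (B k)" for k
    using B0 order_trans[OF BS S1] by (intro integrable_bounded[of _ 1]) auto
  \<comment> \<open>The bound \<open>b\<close> ignores the distance condition; the bound
    \<open>r ^ k\<close> ignores the restriction to \<open>L'\<close> and sums out the letters after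
    the first \<open>k\<close>.\<close>
  have B_le: "(LINT x|\<mu>. B k x) \<le> min b (r ^ k)" if "k < n" for k
  proof (rule min.boundedI)
    show "(LINT x|\<mu>. B k x) \<le> b" unfolding bS by (intro integral_mono B_int S_int BS)
    let ?g = "\<lambda>x es. of_bool (t k < dist (fold w es x) (fold w es (base x))) :: real"
    have "B k x \<le> (\<Sum>es | length es = k. path_prob w p x es * ?g x es)" for x
    proof -
      have "B k x \<le> (\<Sum>es | length es = n. path_prob w p x es * ?g x (take k es))"
        unfolding B_def bad_def by (intro sum_mono2) (auto simp: L'_def path_prob_nonneg)
      then show ?thesis
        using sum_path_prob_take[OF less_imp_le[OF that], of x "?g x"] by simp
    qed
    moreover have "integrable \<mu> (\<lambda>x. \<Sum>es | length es = k. path_prob w p x es * ?g x es)"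
    proof (rule integrable_bounded[of _ 1])
      fix x
      have "(\<Sum>es | length es = k. path_prob w p x es * ?g x es) \<le> (\<Sum>es | length es = k. path_prob w p x es)"
        by (intro sum_mono) (auto simp: path_prob_nonneg)
      moreover have "0 \<le> (\<Sum>es | length es = k. path_prob w p x es * ?g x es)"
        by (intro sum_nonneg) (auto simp: path_prob_nonneg)
      ultimately show "\<bar>\<Sum>es | length es = k. path_prob w p x es * ?g x es\<bar> \<le> 1" by (simp add: sum_path_prob)
    qed measurable
    ultimately have "(LINT x|\<mu>. B k x) \<le> (LINT x|\<mu>. (\<Sum>es | length es = k. path_prob w p x es * ?g x es))"
      by (intro integral_mono B_int)
    also have "\<dots> \<le> r ^ k" unfolding t_def r_def C_def by (rule far_apart_le)
    finally show "(LINT x|\<mu>. B k x) \<le> r ^ k" .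
  qed
  define os where "os x es = (\<Sum>k<n. osc x (base x) es k)" for x es
  define T where "T x = (\<Sum>es\<in>L'. path_prob w p x es * os x es)" for x
  have T_le: "T x \<le> (\<Sum>k<n. D k * S x + B k x)" for x
  proof -
    obtain j where j: "j \<in> {1..N}" "x \<in> K j" "base x \<in> K j" using base_cell by blast
    have "path_prob w p x es * os x es \<le> (\<Sum>k<n. path_prob w p x es * (D k + of_bool (bad k x es)))" for es
    proof (cases "path_prob w p x es = 0")
      case False
      then show ?thesis
        unfolding os_def sum_distrib_left D_def bad_def
        by (intro sum_mono mult_left_mono osc_le[OF _ j t0]) (auto simp: path_prob_nonneg)
    qed simp
    then have "T x \<le> (\<Sum>es\<in>L'. \<Sum>k<n. path_prob w p x es * (D k + of_bool (bad k x es)))"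
      unfolding T_def by (intro sum_mono)
    also have "\<dots> = (\<Sum>k<n. \<Sum>es\<in>L'. path_prob w p x es * (D k + of_bool (bad k x es)))"
      by (rule sum.swap)
    also have "\<dots> = (\<Sum>k<n. D k * S x + B k x)"
      by (simp add: S_def B_def sum_distrib_left distrib_left sum.distrib mult.commute)
    finally show ?thesis .
  qed
  \<comment> \<open>\<open>m\<close> is chosen so that \<open>\<delta> * m * b\<close> bounds the
    integral of the total oscillation over \<open>L'\<close>.\<close>
  define m where "m = (1 / \<delta>) * ((\<Sum>i. D i) + (ln b / ln r + 1 / (1 - r)))"
  define U where "U x = (\<Sum>k<n. D k * S x + B k x)" for x
  have U_int: "integrable \<mu> U" unfolding U_def by (intro Bochner_Integration.integrable_sum Bochner_Integration.integrable_add integrable_mult_right S_int B_int)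
  have U_le: "(LINT x|\<mu>. U x) \<le> \<delta> * m * b"
  proof -
    have "(LINT x|\<mu>. U x) = (\<Sum>k<n. D k * b + (LINT x|\<mu>. B k x))"
      unfolding U_def bS by (simp add: S_int B_int)
    also have "\<dots> \<le> (\<Sum>k<n. D k * b + min b (r ^ k))"
      by (intro sum_mono add_left_mono B_le) auto
    also have "\<dots> = (\<Sum>k<n. D k) * b + (\<Sum>k<n. min b (r ^ k))"
      by (simp add: sum.distrib sum_distrib_right)
    also have "\<dots> \<le> (\<Sum>k. D k) * b + b * (ln b / ln r + 1 / (1 - r))"
      using b D0 by (intro add_mono mult_right_mono sum_le_suminf D_sum sum_min_power_le b b1 r) auto
    also have "\<dots> = \<delta> * m * b"
    proof -
      have "\<delta> * m = (\<Sum>i. D i) + (ln b / ln r + 1 / (1 - r))" unfolding m_def using \<delta> by simp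
      then show ?thesis by (simp only: distrib_right mult.commute[of b])
    qed
    finally show ?thesis .
  qed
  txt \<open>Integrating the tangent line of \<open>exp\<close> at \<open>-m\<close> gives Jensen's inequality.\<close>
  have pointwise: "exp (- m) * ((1 + m) * S x - U x / \<delta>) \<le> (\<Sum>es\<in>L'. path_prob w p (base x) es)" for x
  proof -
    obtain j where j: "j \<in> {1..N}" "x \<in> K j" "base x \<in> K j" using base_cell by blast
    have "exp (- m) * ((1 + m) * S x - U x / \<delta>) \<le> exp (- m) * ((1 + m) * S x - T x / \<delta>)"
      using T_le \<delta> by (simp add: U_def divide_right_mono)
    also have "\<dots> = (\<Sum>es\<in>L'. path_prob w p x es * (exp (- m) * (1 + (m - os x es / \<delta>))))"
      by (simp add: S_def T_def sum_distrib_left sum_divide_distrib sum_subtractf[symmetric] algebra_simps)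
    also have "\<dots> \<le> (\<Sum>es\<in>L'. path_prob w p x es * exp (- (os x es / \<delta>)))"
    proof (intro sum_mono mult_left_mono path_prob_nonneg)
      fix es
      have "exp (- m) * (1 + (m - os x es / \<delta>)) \<le> exp (- m) * exp (m - os x es / \<delta>)"
        by (intro mult_left_mono exp_ge_add_one_self) auto
      then show "exp (- m) * (1 + (m - os x es / \<delta>)) \<le> exp (- (os x es / \<delta>))"
        by (simp add: exp_add[symmetric])
    qed
    also have "\<dots> \<le> (\<Sum>es\<in>L'. path_prob w p (base x) es)"
      unfolding os_def using path_prob_compare[OF \<delta> lb j] len by (intro sum_mono) (fastforce dest: len)
    finally show ?thesis .
  qed
  \<comment> \<open>The tangent is taken at the bound for the mean, so after integration the terms
    in \<open>m\<close> cancel and exactly \<open>b\<close> remains.\<close>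
  have "b * exp (- m) = exp (- m) * ((1 + m) * b - (\<delta> * m * b) / \<delta>)"
    using \<delta> by (simp add: algebra_simps)
  also have "\<dots> \<le> exp (- m) * ((1 + m) * b - (LINT x|\<mu>. U x) / \<delta>)"
    using U_le \<delta> by (intro mult_left_mono diff_left_mono divide_right_mono) auto
  also have "\<dots> = (LINT x|\<mu>. exp (- m) * ((1 + m) * S x - U x / \<delta>))"
    using S_int U_int by (simp add: bS)
  also have "\<dots> \<le> (LINT x|\<mu>. (\<Sum>es\<in>L'. path_prob w p (base x) es))"
  proof (intro integral_mono pointwise)
    show "integrable \<mu> (\<lambda>x. \<Sum>es\<in>L'. path_prob w p (base x) es)"
    proof (rule integrable_bounded[of _ 1])
      show "\<bar>\<Sum>es\<in>L'. path_prob w p (base x) es\<bar> \<le> 1" for x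
        using S0[of "base x"] S1[of "base x"] by (simp add: S_def)
    qed measurable
    show "integrable \<mu> (\<lambda>x. exp (- m) * ((1 + m) * S x - U x / \<delta>))"
      using S_int U_int by auto
  qed
  finally show ?thesis by (simp add: m_def D_def t_def r_def)
qed

text \<open>For word sets this is \<open>path_set_estimate\<close> followed by
  \<open>integral_base\<close>; approximation extends it to the whole future sigma-algebra.\<close>

lemma future_lower_bound:
  defines "C \<equiv> mean_dist N K xs \<mu>"
  assumes \<delta>: "0 < \<delta>" and lb: "\<And>e x. x \<in> K (ini e) \<Longrightarrow> \<delta> \<le> p e x"
    and dini: "\<And>e. dini_continuous_on (K (ini e)) (p e)"
    and \<beta>: "0 < \<beta>" "\<beta> < \<delta> * ln (1 / a) / (1 + \<delta> * ln (1 / a))"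
    and q: "q = \<beta> / ((1 - \<beta>) * \<delta> * ln (1 / a))"
    and M: "code_measure w p \<mu> M"
    and V: "finite V" and pos: "\<And>j. j \<in> {1..N} \<Longrightarrow> measure \<mu> (K j) > 0 \<Longrightarrow> j \<in> V"
    and A: "A \<in> sets (future 0)"
  shows "exp (- (1 / \<delta>) * (1 / (1 - a powr q) + (\<Sum>i. Delta K ini p (a powr ((1 - q) * real i) * C))))
      * measure M A powr (1 / \<beta>) \<le> (\<Sum>i\<in>V. measure (path_measure w p 0 (xs i)) A)"
proof (rule lower_bound_from_words[OF V _ _ _ _ _ _ A])
  have setsM: "sets M = sets code_borel" and "prob_space M" using M by (auto simp: code_measure_def)
  then interpret M: prob_space M by simp
  show fM: "finite_measure M" by unfold_locales
  show subM: "sets (future 0) \<subseteq> sets M" using setsM sets_future_subset by simp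
  show fP: "finite_measure (path_measure w p 0 (xs i))" for i
    using prob_space_path_measure by (rule prob_space.finite_measure)
  show setsP: "sets (path_measure w p 0 (xs i)) = sets (future 0)" for i
    by (rule sets_path_measure)
  show "0 < 1 / \<beta>" using \<beta> by simp
  fix B :: "(int \<Rightarrow> 'e) set" assume "B \<in> word_sets"
  then obtain n L where nL: "n > 0" "B = word n -` L" by (auto simp: word_sets_def)
  define L' where "L' = {es. es \<in> L \<and> length es = n}"
  define b where "b = (LINT x|\<mu>. (\<Sum>es\<in>L'. path_prob w p x es))"
  have cyl: "es \<noteq> []" if "es \<in> L'" for es
    using that nL by (auto simp: L'_def)
  have int: "integrable \<mu> (\<lambda>x. path_prob w p x es)" for es
    by (rule integrable_bounded[of _ 1]) (auto simp: path_prob_nonneg path_prob_le_1)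
  have MB: "measure M B = b"
  proof -
    have "measure M B = (\<Sum>es\<in>L'. measure M (cylinder 0 es))"
      unfolding nL(2) L'_def by (rule measure_word_vimage[OF fM subM nL(1)])
    also have "\<dots> = (\<Sum>es\<in>L'. LINT x|\<mu>. path_prob w p x es)"
      using M cyl by (intro sum.cong refl) (simp add: code_measure_def measure_path_measure_cylinder)
    finally show ?thesis by (simp add: b_def int)
  qed
  have PB: "measure (path_measure w p 0 x) B = (\<Sum>es\<in>L'. path_prob w p x es)" for x
  proof -
    have "measure (path_measure w p 0 x) B = (\<Sum>es\<in>L'. measure (path_measure w p 0 x) (cylinder 0 es))"
      unfolding nL(2) L'_def
      by (rule measure_word_vimage) (auto simp: sets_path_measure nL intro: prob_space.finite_measure prob_space_path_measure)
    then show ?thesis using cyl by (simp add: measure_path_measure_cylinder)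
  qed
  show "exp (- (1 / \<delta>) * (1 / (1 - a powr q) + (\<Sum>i. Delta K ini p (a powr ((1 - q) * real i) * C))))
      * measure M B powr (1 / \<beta>) \<le> (\<Sum>i\<in>V. measure (path_measure w p 0 (xs i)) B)"
  proof (cases "b = 0")
    case True
    then show ?thesis using \<beta> by (simp add: MB sum_nonneg)
  next
    case False
    then have b: "0 < b" using MB measure_nonneg[of M B] by simp
    have a: "0 < a" "a < 1" using contractive by (auto simp: contractive_def)
    define l where "l = ln (1 / a)"
    have l: "0 < l" "ln a = - l" using a by (auto simp: l_def ln_div)
    have "0 < 1 + \<delta> * l" using \<delta> l by (simp add: add_pos_pos)
    then have \<beta>1: "\<beta> * (1 + \<delta> * l) < \<delta> * l" using \<beta>(2) by (simp add: l_def field_simps)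
    then have "\<beta> * (1 + \<delta> * l) < 1 * (1 + \<delta> * l)" by simp
    then have "\<beta> < 1" using \<open>0 < 1 + \<delta> * l\<close> by (simp only: mult_less_cancel_right_pos)
    have q0: "0 < q" using \<beta>(1) \<open>\<beta> < 1\<close> \<delta> l by (simp add: q l_def[symmetric])
    \<comment> \<open>The upper bound assumed for \<open>\<beta>\<close> is equivalent to
      \<open>q < 1\<close> here.\<close>
    have q1: "q < 1" using \<beta>1 \<open>\<beta> < 1\<close> \<delta> l by (simp add: q l_def[symmetric] field_simps)
    define D where "D = (\<Sum>i. Delta K ini p (a powr ((1 - q) * real i) * C))"
    have "b * exp (- (1 / \<delta>) * (D + (ln b / ln (a powr q) + 1 / (1 - a powr q))))
        \<le> (LINT x|\<mu>. (\<Sum>es\<in>L'. path_prob w p (base x) es))"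
      using path_set_estimate[OF \<delta> lb dini q0 q1, of L n] b
      unfolding D_def C_def b_def L'_def by simp
    also have "\<dots> \<le> (\<Sum>i\<in>V. \<Sum>es\<in>L'. path_prob w p (xs i) es)"
      by (intro integral_base V pos) (auto simp: sum_nonneg path_prob_nonneg)
    also have "b * exp (- (1 / \<delta>) * (D + (ln b / ln (a powr q) + 1 / (1 - a powr q)))) =
      exp (- (1 / \<delta>) * (1 / (1 - a powr q) + D)) * b powr (1 / \<beta>)"
    proof -
      \<comment> \<open>By the choice of \<open>q\<close>, \<open>ln (a powr q)\<close> is
        \<open>- \<beta> / ((1 - \<beta>) * \<delta>)\<close>. The logarithmic term thus contributes
        the power \<open>1 / \<beta> - 1\<close> of \<open>b\<close>, and the factor
        \<open>b\<close> in front completes it to \<open>1 / \<beta>\<close>.\<close>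
      have "- (1 / \<delta>) * (ln b / ln (a powr q)) = (1 / \<beta> - 1) * ln b"
        using a l \<delta> \<beta>(1) \<open>\<beta> < 1\<close> by (simp add: ln_powr q l_def[symmetric]) (simp add: field_simps)
      then have "exp (- (1 / \<delta>) * (D + (ln b / ln (a powr q) + 1 / (1 - a powr q)))) =
        exp (- (1 / \<delta>) * (1 / (1 - a powr q) + D)) * exp ((1 / \<beta> - 1) * ln b)"
        unfolding exp_add[symmetric] by (simp add: algebra_simps)
      moreover have "b * exp ((1 / \<beta> - 1) * ln b) = b powr (1 / \<beta>)"
        using b by (simp add: powr_def left_diff_distrib exp_diff)
      ultimately show ?thesis by simp
    qed
    finally show ?thesis by (simp add: MB PB D_def)
  qed
qed

end

section \<open>From events in the future to arbitrary covers\<close>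

lemma ennpow_ennreal: "0 \<le> u \<Longrightarrow> ennpow (ennreal u) s = ennreal (u powr s)"
  by (simp add: ennpow_def)

lemma ennpow_mono: "x \<le> y \<Longrightarrow> 0 \<le> s \<Longrightarrow> ennpow x s \<le> ennpow y s"
  by (cases x; cases y) (auto simp: ennpow_def top_unique intro!: ennreal_leI powr_mono2)

text \<open>Every partial sum of the series is a finite subsum of the unordered sum.\<close>

lemma suminf_le_infsum:
  fixes f :: "int \<Rightarrow> ennreal"
  shows "(\<Sum>n. f (- int n)) \<le> (\<Sum>\<^sub>\<infinity>m\<in>{..0}. f m)"
  unfolding suminf_eq_SUP
proof (rule SUP_least)
  fix n
  have "(\<Sum>i<n. f (- int i)) = sum f ((\<lambda>i. - int i) ` {..<n})"
    by (subst sum.reindex) (auto simp: inj_on_def)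
  also have "\<dots> \<le> (\<Sum>\<^sub>\<infinity>m\<in>{..0}. f m)"
    by (subst nonneg_infsum_complete) (auto intro!: SUP_upper)
  finally show "(\<Sum>i<n. f (- int i)) \<le> (\<Sum>\<^sub>\<infinity>m\<in>{..0}. f m)" .
qed

text \<open>Raising the hypothesis to the power \<open>\<beta>\<close> makes it linear in the
  measure. Shift invariance and countable subadditivity then sum it over a cover, and the power
  \<open>1 / \<beta>\<close> restores the original scale.\<close>

lemma Phi_beta_lower_bound:
  fixes M :: "(int \<Rightarrow> 'e) measure"
  assumes M: "prob_space M" "sets M = sets code_borel" "shift_invariant M"
    and "0 < \<beta>" "0 \<le> c" and Q: "Q \<in> sets code_borel"
    and \<phi>: "\<And>A. A \<in> sets (future 0) \<Longrightarrow> ennreal (c * measure M A powr (1 / \<beta>)) \<le> \<phi> A"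
  shows "ennreal (measure M Q powr (1 / \<beta>) * c) \<le> Phi_beta \<phi> \<beta> Q"
  unfolding Phi_beta_def
proof (rule INF_greatest)
  interpret prob_space M by fact
  fix A assume A: "A \<in> covers Q"
  then have Af: "\<And>m. m \<le> 0 \<Longrightarrow> A m \<in> sets (future m)" and QA: "Q \<subseteq> (\<Union>m\<in>{..0}. A m)"
    by (auto simp: covers_def)
  have Asets: "A (- int n) \<in> sets M" for n
    using Af[of "- int n"] sets_future_subset M(2) by auto
  have le: "ennreal (c powr \<beta>) * emeasure M (A m) \<le> ennpow (\<phi> (shift m ` A m)) \<beta>" if "m \<le> 0" for m
  proof -
    have "emeasure M (shift m ` A m) = emeasure M (A m)"
      using M Af[OF that] sets_future_subset that by (intro shift_invariant_measure) auto
    then have eq: "measure M (shift m ` A m) = measure M (A m)" by (simp add: measure_def)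
    have "ennreal (c powr \<beta>) * emeasure M (A m) = ennreal (c powr \<beta> * measure M (A m))"
      by (simp add: emeasure_eq_measure ennreal_mult)
    also have "c powr \<beta> * measure M (A m) = (c * measure M (A m) powr (1 / \<beta>)) powr \<beta>"
      using \<open>0 < \<beta>\<close> \<open>0 \<le> c\<close> by (simp add: powr_mult powr_powr)
    also have "ennreal \<dots> = ennpow (ennreal (c * measure M (A m) powr (1 / \<beta>))) \<beta>"
      using \<open>0 \<le> c\<close> by (simp add: ennpow_ennreal)
    also have "\<dots> \<le> ennpow (\<phi> (shift m ` A m)) \<beta>"
      using \<phi>[OF shift_image_future[OF Af[OF that]]] \<open>0 < \<beta>\<close> by (intro ennpow_mono) (auto simp: eq)
    finally show ?thesis .
  qed
  have "Q \<subseteq> (\<Union>n. A (- int n))"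
  proof
    fix x assume "x \<in> Q"
    then obtain m where "m \<le> 0" "x \<in> A m" using QA by auto
    then have "x \<in> A (- int (nat (- m)))" by simp
    then show "x \<in> (\<Union>n. A (- int n))" by blast
  qed
  then have "emeasure M Q \<le> emeasure M (\<Union>n. A (- int n))"
    using Asets by (intro emeasure_mono) auto
  also have "\<dots> \<le> (\<Sum>n. emeasure M (A (- int n)))"
    using Asets by (intro emeasure_subadditive_countably) auto
  finally have "ennreal (c powr \<beta>) * emeasure M Q \<le> ennreal (c powr \<beta>) * (\<Sum>n. emeasure M (A (- int n)))"
    by (intro mult_left_mono) auto
  also have "\<dots> = (\<Sum>n. ennreal (c powr \<beta>) * emeasure M (A (- int n)))"
    by simp
  also have "\<dots> \<le> (\<Sum>n. ennpow (\<phi> (shift (- int n) ` A (- int n))) \<beta>)"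
    using le by (intro suminf_le) auto
  also have "\<dots> \<le> (\<Sum>\<^sub>\<infinity>m\<in>{..0}. ennpow (\<phi> (shift m ` A m)) \<beta>)"
    by (rule suminf_le_infsum)
  finally have "ennpow (ennreal (c powr \<beta>) * emeasure M Q) (1 / \<beta>)
      \<le> ennpow (\<Sum>\<^sub>\<infinity>m\<in>{..0}. ennpow (\<phi> (shift m ` A m)) \<beta>) (1 / \<beta>)"
    using \<open>0 < \<beta>\<close> by (intro ennpow_mono) auto
  moreover have "ennpow (ennreal (c powr \<beta>) * emeasure M Q) (1 / \<beta>) = ennreal ((c powr \<beta> * measure M Q) powr (1 / \<beta>))"
    by (simp add: emeasure_eq_measure ennreal_mult[symmetric] ennpow_ennreal)
  moreover have "(c powr \<beta> * measure M Q) powr (1 / \<beta>) = measure M Q powr (1 / \<beta>) * c"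
    using \<open>0 < \<beta>\<close> \<open>0 \<le> c\<close> by (simp add: powr_mult powr_powr)
  ultimately show "ennreal (measure M Q powr (1 / \<beta>) * c)
      \<le> ennpow (\<Sum>\<^sub>\<infinity>m\<in>{..0}. ennpow (\<phi> (shift m ` A m)) \<beta>) (1 / \<beta>)" by simp
qed

section \<open>The bound for all Borel sets of codes\<close>

theorem lemma3:
  fixes N :: nat
    and K :: "nat \<Rightarrow> 'a::polish_space set"
    and ini ter :: "'e::finite \<Rightarrow> nat"
    and w :: "'e \<Rightarrow> 'a \<Rightarrow> 'a"
    and p :: "'e \<Rightarrow> 'a \<Rightarrow> real"
    and \<mu> :: "'a measure"
    and M :: "(int \<Rightarrow> 'e) measure"
    and xs :: "nat \<Rightarrow> 'a"
    and V :: "nat set"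
    and a \<delta> \<beta> q :: real
    and Q :: "(int \<Rightarrow> 'e) set"
  assumes "markov_system N K ini ter w p"
    and "invariant_measure K ini w p \<mu>"
    and "code_measure w p \<mu> M"
    and "\<And>i. i \<in> {1..N} \<Longrightarrow> xs i \<in> K i"
    and "{i \<in> {1..N}. measure M (coding_map ini ter w xs -` K i) > 0} \<subseteq> V"
    and "V \<subseteq> {1..N}"
    and "contractive N K ini w p a"
    and "\<And>e. dini_continuous_on (K (ini e)) (p e)"
    and "\<delta> > 0"
    and "\<And>e x. x \<in> K (ini e) \<Longrightarrow> p e x \<ge> \<delta>"
    and "M \<in> E_class ini ter w p xs"
    and "0 < \<beta>" and "\<beta> < \<delta> * ln (1 / a) / (1 + \<delta> * ln (1 / a))"
    and "q = \<beta> / ((1 - \<beta>) * \<delta> * ln (1 / a))"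
    and "Q \<in> sets code_borel"
  shows "Phi_beta (Phi_0 w p (initial_measure V xs)) \<beta> Q \<ge>
    ennreal (measure M Q powr (1 / \<beta>) * (1 / real (card V)) *
      exp (- (1 / \<delta>) * (1 / (1 - a powr q) +
        (\<Sum>i. Delta K ini p (a powr ((1 - q) * real i) * mean_dist N K xs \<mu>)))))"
proof (cases "V = {}")
  case True
  \<comment> \<open>For empty \<open>V\<close> the factor \<open>1 / real (card V)\<close> is
    \<open>1 / 0 = 0\<close>, so the lower bound is 0.\<close>
  then show ?thesis by simp
next
  case False
  interpret coded_markov_system N K ini ter w p \<mu> xs a
    using assms(1,2,4,7) by (simp add: coded_markov_system_def coded_markov_system_axioms_def)
  have V: "finite V" using assms(6) by (rule finite_subset) simp
  have M: "prob_space M" "sets M = sets code_borel" "shift_invariant M"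
    using assms(3) by (auto simp: code_measure_def)
  \<comment> \<open>The cells charged by \<open>\<mu>\<close> are those charged through the coding
    map, so \<open>V\<close> contains their indices.\<close>
  have pos: "j \<in> V" if "j \<in> {1..N}" "measure \<mu> (K j) > 0" for j
    using that invariant_cell_measure[OF assms(2,3,11) that(1)] assms(5) by auto
  let ?E = "exp (- (1 / \<delta>) * (1 / (1 - a powr q) +
        (\<Sum>i. Delta K ini p (a powr ((1 - q) * real i) * mean_dist N K xs \<mu>))))"
  have "ennreal (measure M Q powr (1 / \<beta>) * (?E / real (card V)))
      \<le> Phi_beta (Phi_0 w p (initial_measure V xs)) \<beta> Q"
  proof (rule Phi_beta_lower_bound[OF M assms(12) _ assms(15)])
    fix A :: "(int \<Rightarrow> 'e) set" assume A: "A \<in> sets (future 0)"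
    have "?E * measure M A powr (1 / \<beta>) \<le> (\<Sum>i\<in>V. measure (path_measure w p 0 (xs i)) A)"
      by (rule future_lower_bound[OF assms(9,10,8,12,13,14,3) V pos A])
    then show "ennreal (?E / real (card V) * measure M A powr (1 / \<beta>))
        \<le> Phi_0 w p (initial_measure V xs) A"
      unfolding Phi_0_initial_measure[OF V False A]
      by (intro ennreal_leI) (simp add: divide_right_mono)
  qed simp
  then show ?thesis by (simp add: mult_ac)
qed

end
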